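(* If $q$ is a prime power and $q-1$ has a proper divisor $d\neq 1$ (i.e. a positive divisor $d$ of $q-1$ with $d\neq q-1$ and $d\neq 1$), then there exist $d-1$ mutually orthogonal quantum Latin squares of order $q$, exactly one of which is non-classical.
   Context: A quantum Latin square of order $n$ is an $n\times n$ matrix with entries in $\mathbb{C}^n$ such that the entries of each row and the entries of each column form an orthonormal basis of $\mathbb{C}^n$. Two quantum Latin squares $(\psi_{ij})$ and $(\phi_{ij})$ of order $n$ are orthogonal if $\{\psi_{ij}\otimes\phi_{ij}\}_{i,j}$ is an orthonormal basis of $\mathbb{C}^n\otimes\mathbb{C}^n$. A set of $t$ mutually orthogonal quantum Latin squares of order $n$ is a set of $t$ quantum Latin squares of order $n$ any two (distinct) of which are orthogonal (for $t=1$, a single quantum Latin square). Two quantum Latin squares are isotopic if they can be obtained from one another by multiplying each entry by a phase factor (a complex number of modulus one, which may depend on the entry), permuting rows and columns, and applying one unitary transformation of $\mathbb{C}^n$ to all entries. A quantum Latin square is classical if it is isotopic to one all of whose entries lie in a fixed orthonormal basis $\{|1\rangle,\dots,|n\rangle\}$ of $\mathbb{C}^n$ (this does not depend on the chosen basis); otherwise it is non-classical. *)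

theory Defs
  imports
    "Jordan_Normal_Form.Schur_Decomposition"
    "HOL-Number_Theory.Prime_Powers"
    "HOL-Combinatorics.Permutations"
begin

(* Vectors of C^n are elements of carrier_vec n, and the inner product is
   v \<bullet>c w, the sum of v $ i * cnj (w $ i). *)

(* An indexed family, so that repeated vectors are excluded. *)
definition orthonormal_basis :: "nat \<Rightarrow> 'i set \<Rightarrow> ('i \<Rightarrow> complex vec) \<Rightarrow> bool" where
  "orthonormal_basis n I v \<longleftrightarrow>
     vectorspace.basis class_ring (module_vec TYPE(complex) n) (v ` I) \<and>
     (\<forall>i\<in>I. \<forall>j\<in>I. v i \<bullet>c v j = (if i = j then 1 else 0))"

(* C^m \<otimes> C^n is identified with C^(m * n) by sending
   e_a \<otimes> e_b to e_(a * n + b), i.e. this is the Kronecker product. *)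
definition tensor_vec :: "complex vec \<Rightarrow> complex vec \<Rightarrow> complex vec" where
  "tensor_vec v w =
     vec (dim_vec v * dim_vec w) (\<lambda>k. v $ (k div dim_vec w) * w $ (k mod dim_vec w))"

definition unitary_mat :: "nat \<Rightarrow> complex mat \<Rightarrow> bool" where
  "unitary_mat n U \<longleftrightarrow> U \<in> carrier_mat n n \<and>
     mat_adjoint U * U = 1\<^sub>m n \<and> U * mat_adjoint U = 1\<^sub>m n"

definition quantum_latin_square :: "nat \<Rightarrow> complex vec mat \<Rightarrow> bool" where
  "quantum_latin_square n A \<longleftrightarrow> A \<in> carrier_mat n n \<and>
     (\<forall>i<n. orthonormal_basis n {..<n} (\<lambda>j. A $$ (i, j))) \<and>
     (\<forall>j<n. orthonormal_basis n {..<n} (\<lambda>i. A $$ (i, j)))"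

definition orthogonal_qls :: "nat \<Rightarrow> complex vec mat \<Rightarrow> complex vec mat \<Rightarrow> bool" where
  "orthogonal_qls n A B \<longleftrightarrow>
     orthonormal_basis (n * n) ({..<n} \<times> {..<n}) (\<lambda>ij. tensor_vec (A $$ ij) (B $$ ij))"

definition mutually_orthogonal_qls :: "nat \<Rightarrow> complex vec mat set \<Rightarrow> bool" where
  "mutually_orthogonal_qls n S \<longleftrightarrow>
     (\<forall>A\<in>S. quantum_latin_square n A) \<and>
     (\<forall>A\<in>S. \<forall>B\<in>S. A \<noteq> B \<longrightarrow> orthogonal_qls n A B)"

definition isotopic_qls :: "nat \<Rightarrow> complex vec mat \<Rightarrow> complex vec mat \<Rightarrow> bool" where
  "isotopic_qls n A B \<longleftrightarrow>
     (\<exists>\<sigma> \<tau> c U. \<sigma> permutes {..<n} \<and> \<tau> permutes {..<n} \<and>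
        (\<forall>i<n. \<forall>j<n. cmod (c i j) = 1) \<and> unitary_mat n U \<and>
        (\<forall>i<n. \<forall>j<n. B $$ (i, j) = c i j \<cdot>\<^sub>v (U *\<^sub>v (A $$ (\<sigma> i, \<tau> j)))))"

definition classical_qls :: "nat \<Rightarrow> complex vec mat \<Rightarrow> bool" where
  "classical_qls n A \<longleftrightarrow>
     (\<exists>B. quantum_latin_square n B \<and> isotopic_qls n A B \<and>
        (\<forall>i<n. \<forall>j<n. B $$ (i, j) \<in> set (unit_vecs n)))"

end

theory Submission
  imports
    "HOL-Algebra.Algebraic_Closure"
    "HOL-Number_Theory.Residues"
    Defs
begin

text \<open>
  Let \<open>F\<close> be the field with \<open>q\<close> elements, \<open>\<chi>\<close> a nontrivial additive character of \<open>F\<close> and \<open>H\<close> the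
  group of \<open>d\<close>-th roots of unity in \<open>F\<close>, which has order \<open>d\<close>. To a point \<open>(a, b)\<close> of the plane
  \<open>F\<^sup>2\<close> attach the unit vector
    \<open>\<psi>(a, b) = (\<chi>(u x) / sqrt q)\<^sub>x\<close> with \<open>u = a\<close> if \<open>x \<in> H\<close> and \<open>u = b\<close> otherwise,
  whose coordinates are indexed by \<open>x \<in> F\<close>. With \<open>\<alpha> = a - a'\<close> and \<open>\<beta> = b - b'\<close>, the inner product of
  \<open>\<psi>(a, b)\<close> and \<open>\<psi>(a', b')\<close> is the average of \<open>\<chi>(\<alpha> x)\<close> on \<open>H\<close> and \<open>\<chi>(\<beta> x)\<close> off \<open>H\<close>. If
  \<open>\<alpha> = h \<beta>\<close> with \<open>h \<in> H\<close> and \<open>\<beta> \<noteq> 0\<close>, then the map that is multiplication by \<open>h\<close> on \<open>H\<close> and the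
  identity elsewhere permutes \<open>F\<close>, so that this is the average of \<open>\<chi>\<close> over \<open>F\<close>, which is zero
  (\<open>sum_\<chi>_twisted\<close>). Hence \<open>\<psi>\<close> is orthonormal on every line \<open>a - h b = const\<close> with \<open>h \<in> H\<close>, and
  these lines form \<open>d\<close> parallel classes.

  A family of parallel classes, any two of which coordinatize the points, is a net. Two of the classes
  serve as the rows and columns of a square; each of the other \<open>d - 2\<close> classes gives a classical
  square, whose entry in a cell is the basis vector numbered by the line through that cell. These are
  mutually orthogonal, as lines of different classes meet only once. The square of \<open>\<psi>\<close> is orthogonal
  to each of them, because cells with equal classical entries lie on one line and there \<open>\<psi>\<close> is
  orthonormal (\<open>mutually_orthogonal_one_nonclassical\<close>). Altogether there are \<open>d - 1\<close> squares.

  Isotopy preserves the moduli of the inner products of entries, so those of a classical square are 0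
  or 1 (\<open>classical_qls_cmod_cinner\<close>). The inner product of \<open>\<psi>(1, 0)\<close> and \<open>\<psi>(0, 0)\<close> is the average of
  the \<open>d\<close> numbers \<open>\<chi>(x)\<close>, \<open>x \<in> H\<close>, and \<open>q - d\<close> ones. It is nonzero, because \<open>d\<close> is a proper divisor of
  \<open>q - 1\<close> and so \<open>2 d < q\<close>; its modulus is less than 1, because \<open>\<chi>(1) \<noteq> 1\<close>. Hence the square of \<open>\<psi>\<close>
  is not classical.

  It remains to construct \<open>F\<close> and \<open>\<chi>\<close>. The field consists of the roots of \<open>X\<^sup>q - X\<close> in an algebraic
  closure of the prime field (\<open>exists_finite_field\<close>), and the character comes from a maximal subgroup
  of the additive group that avoids 1 (\<open>exists_nontrivial_character\<close>).
\<close>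

section \<open>Finite fields of prime power order\<close>

lemma (in cring) binomial_ring:
  assumes x: "x \<in> carrier R" and y: "y \<in> carrier R"
  shows "(x \<oplus> y) [^] (n::nat) = (\<Oplus>i\<in>{..n}. [(n choose i)] \<cdot> (x [^] i \<otimes> y [^] (n - i)))"
proof (induction n)
  case 0
  show ?case using x y by (simp add: add.nat_pow_eone)
next
  case (Suc n)
  let ?t = "\<lambda>i. [(n choose i)] \<cdot> (x [^] i \<otimes> y [^] (n - i))"
  let ?f = "\<lambda>i. [(n choose i)] \<cdot> (x [^] i \<otimes> y [^] (Suc n - i))"
  \<comment> \<open>\<open>?f\<close> and \<open>?g\<close> are the terms contributed by \<open>y\<close> and by \<open>x\<close>, indexed by the exponent of \<open>x\<close>; they add up by Pascal's rule.\<close>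
  let ?g = "\<lambda>i. if i = 0 then \<zero> else [(n choose (i - 1))] \<cdot> (x [^] i \<otimes> y [^] (Suc n - i))"
  have t: "?t \<in> {..n} \<rightarrow> carrier R" using x y by auto
  have "x \<otimes> (\<Oplus>i\<in>{..n}. ?t i) = (\<Oplus>i\<in>{..n}. x \<otimes> ?t i)"
    using t x by (intro finsum_rdistr) auto
  also have "\<dots> = (\<Oplus>i\<in>{..n}. ?g (Suc i))"
    using x y by (intro finsum_cong') (auto simp: add_pow_rdistr m_ac)
  also have "\<dots> = (\<Oplus>i\<in>{..n}. ?g (Suc i)) \<oplus> ?g 0"
    using x y by (simp add: finsum_closed Pi_def binomial_eq_0)
  also have "\<dots> = (\<Oplus>i\<in>{..Suc n}. ?g i)"
    using x y by (intro finsum_Suc2[symmetric]) auto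
  finally have X: "x \<otimes> (\<Oplus>i\<in>{..n}. ?t i) = (\<Oplus>i\<in>{..Suc n}. ?g i)" .
  have "y \<otimes> (\<Oplus>i\<in>{..n}. ?t i) = (\<Oplus>i\<in>{..n}. y \<otimes> ?t i)"
    using t y by (intro finsum_rdistr) auto
  also have "\<dots> = (\<Oplus>i\<in>{..n}. ?f i)"
    using x y by (intro finsum_cong') (auto simp: add_pow_rdistr Suc_diff_le m_ac)
  also have "\<dots> = ?f (Suc n) \<oplus> (\<Oplus>i\<in>{..n}. ?f i)"
    using x y by (simp add: finsum_closed Pi_def binomial_eq_0)
  also have "\<dots> = (\<Oplus>i\<in>{..Suc n}. ?f i)"
    using x y by (intro finsum_Suc[symmetric]) auto
  finally have Y: "y \<otimes> (\<Oplus>i\<in>{..n}. ?t i) = (\<Oplus>i\<in>{..Suc n}. ?f i)" .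
  have "(x \<oplus> y) [^] Suc n = (x \<oplus> y) \<otimes> (\<Oplus>i\<in>{..n}. ?t i)"
    unfolding nat_pow_Suc Suc.IH using x y t by (intro m_comm finsum_closed) auto
  also have "\<dots> = (\<Oplus>i\<in>{..Suc n}. ?g i) \<oplus> (\<Oplus>i\<in>{..Suc n}. ?f i)"
    using x y t by (subst l_distr) (auto simp: X Y intro: finsum_closed)
  also have "\<dots> = (\<Oplus>i\<in>{..Suc n}. ?g i \<oplus> ?f i)"
    using x y by (intro finsum_addf[symmetric]) auto
  also have "\<dots> = (\<Oplus>i\<in>{..Suc n}. [(Suc n choose i)] \<cdot> (x [^] i \<otimes> y [^] (Suc n - i)))"
  proof (intro finsum_cong')
    fix i assume "i \<in> {..Suc n}"
    show "?g i \<oplus> ?f i = [(Suc n choose i)] \<cdot> (x [^] i \<otimes> y [^] (Suc n - i))"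
      using x y by (cases i) (auto simp: add.nat_pow_mult)
  qed (use x y in auto)
  finally show ?case .
qed

text \<open>
  The inner binomial coefficients are divisible by \<open>p\<close>, so only the two outer terms of the binomial
  expansion survive.
\<close>
lemma (in cring) frobenius_add:
  assumes x: "x \<in> carrier R" and y: "y \<in> carrier R"
    and p: "prime (p::nat)" and char: "\<And>z. z \<in> carrier R \<Longrightarrow> [p] \<cdot> z = \<zero>"
  shows "(x \<oplus> y) [^] p = x [^] p \<oplus> y [^] p"
proof -
  obtain m where m: "p = Suc (Suc m)"
    using prime_ge_2_nat[OF p] by (metis add_2_eq_Suc nat_le_iff_add)
  let ?f = "\<lambda>i. [(p choose i)] \<cdot> (x [^] i \<otimes> y [^] (p - i))"
  have mid: "?f (Suc i) = \<zero>" if "i \<in> {..m}" for i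
  proof -
    have "p dvd (p choose Suc i)"
      using that m by (intro dvd_choose_prime p) auto
    then obtain k where k: "(p choose Suc i) = p * k" by blast
    show ?thesis unfolding k using x y by (simp add: add.nat_pow_pow[symmetric] char)
  qed
  have "(x \<oplus> y) [^] p = (\<Oplus>i\<in>{..Suc (Suc m)}. ?f i)"
    using binomial_ring[OF x y, of p] by (simp add: m)
  also have "\<dots> = (\<Oplus>i\<in>{..Suc m}. ?f (Suc i)) \<oplus> ?f 0"
    using x y by (intro finsum_Suc2) auto
  also have "(\<Oplus>i\<in>{..Suc m}. ?f (Suc i)) = ?f (Suc (Suc m)) \<oplus> (\<Oplus>i\<in>{..m}. ?f (Suc i))"
    using x y by (intro finsum_Suc) auto
  also have "(\<Oplus>i\<in>{..m}. ?f (Suc i)) = \<zero>"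
    using mid by (rule add.finprod_one_eqI)
  finally show ?thesis using x y by (simp add: m)
qed

lemma (in cring) frobenius_power_add:
  assumes x: "x \<in> carrier R" and y: "y \<in> carrier R"
    and p: "prime (p::nat)" and char: "\<And>z. z \<in> carrier R \<Longrightarrow> [p] \<cdot> z = \<zero>"
  shows "(x \<oplus> y) [^] (p ^ k) = x [^] (p ^ k) \<oplus> y [^] (p ^ k)"
proof (induction k)
  case (Suc k)
  have "(x \<oplus> y) [^] (p ^ Suc k) = ((x \<oplus> y) [^] (p ^ k)) [^] p"
    using x y by (simp add: nat_pow_pow mult.commute)
  also have "\<dots> = x [^] (p ^ Suc k) \<oplus> y [^] (p ^ Suc k)"
    unfolding Suc using x y by (simp add: frobenius_add[OF _ _ p char] nat_pow_pow mult.commute)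
  finally show ?case .
qed (use x y in auto)

text \<open>
  The cofactor \<open>s\<close> of \<open>x - c\<close> in \<open>x\<^sup>n - c\<^sup>n\<close> is \<open>\<Sum>i<n. x\<^sup>i c\<^sup>n\<^sup>-\<^sup>1\<^sup>-\<^sup>i\<close>; a homomorphism that identifies \<open>x\<close> with
  \<open>c\<close> sends it to \<open>n c\<^sup>n\<^sup>-\<^sup>1\<close>. Applied to the evaluation of polynomials at a root, this is the value of
  the derivative of \<open>X\<^sup>n - 1\<close> and shows that its roots are simple. The factor \<open>h c\<close> in the second
  equation avoids the exponent \<open>n - 1\<close>.
\<close>
lemma (in ring_hom_cring) power_diff_cofactor:
  assumes x: "x \<in> carrier R" and c: "c \<in> carrier R" and h: "h x = h c"
  shows "\<exists>s\<in>carrier R. x [^]\<^bsub>R\<^esub> (n::nat) \<ominus>\<^bsub>R\<^esub> c [^]\<^bsub>R\<^esub> n = (x \<ominus>\<^bsub>R\<^esub> c) \<otimes>\<^bsub>R\<^esub> s \<and>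
           h c \<otimes>\<^bsub>S\<^esub> h s = [n] \<cdot>\<^bsub>S\<^esub> (h c [^]\<^bsub>S\<^esub> n)"
proof (induction n)
  case 0
  show ?case using x c by (intro bexI[of _ "\<zero>\<^bsub>R\<^esub>"]) (auto simp: R.minus_eq R.r_neg)
next
  case (Suc n)
  then obtain s where s: "s \<in> carrier R"
    and eq: "x [^]\<^bsub>R\<^esub> n \<ominus>\<^bsub>R\<^esub> c [^]\<^bsub>R\<^esub> n = (x \<ominus>\<^bsub>R\<^esub> c) \<otimes>\<^bsub>R\<^esub> s"
    and hs: "h c \<otimes>\<^bsub>S\<^esub> h s = [n] \<cdot>\<^bsub>S\<^esub> (h c [^]\<^bsub>S\<^esub> n)" by auto
  let ?s = "x \<otimes>\<^bsub>R\<^esub> s \<oplus>\<^bsub>R\<^esub> c [^]\<^bsub>R\<^esub> n"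
  have xn: "x [^]\<^bsub>R\<^esub> n \<in> carrier R" and cn: "c [^]\<^bsub>R\<^esub> n \<in> carrier R" using x c by auto
  have "(x \<ominus>\<^bsub>R\<^esub> c) \<otimes>\<^bsub>R\<^esub> ?s = x \<otimes>\<^bsub>R\<^esub> ((x \<ominus>\<^bsub>R\<^esub> c) \<otimes>\<^bsub>R\<^esub> s) \<oplus>\<^bsub>R\<^esub> (x \<ominus>\<^bsub>R\<^esub> c) \<otimes>\<^bsub>R\<^esub> c [^]\<^bsub>R\<^esub> n"
    using x c s cn by algebra
  also have "\<dots> = x [^]\<^bsub>R\<^esub> n \<otimes>\<^bsub>R\<^esub> x \<ominus>\<^bsub>R\<^esub> c [^]\<^bsub>R\<^esub> n \<otimes>\<^bsub>R\<^esub> c"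
    unfolding eq[symmetric] using x c xn cn by algebra
  finally have "x [^]\<^bsub>R\<^esub> Suc n \<ominus>\<^bsub>R\<^esub> c [^]\<^bsub>R\<^esub> Suc n = (x \<ominus>\<^bsub>R\<^esub> c) \<otimes>\<^bsub>R\<^esub> ?s"
    by (simp add: R.nat_pow_Suc)
  moreover have "h c \<otimes>\<^bsub>S\<^esub> h ?s = [Suc n] \<cdot>\<^bsub>S\<^esub> (h c [^]\<^bsub>S\<^esub> Suc n)"
  proof -
    have "h c \<otimes>\<^bsub>S\<^esub> h ?s = h c \<otimes>\<^bsub>S\<^esub> (h c \<otimes>\<^bsub>S\<^esub> h s \<oplus>\<^bsub>S\<^esub> h c [^]\<^bsub>S\<^esub> n)"
      using x c s h ring.hom_nat_pow[OF c, of n] by simp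
    also have "\<dots> = h c \<otimes>\<^bsub>S\<^esub> [Suc n] \<cdot>\<^bsub>S\<^esub> (h c [^]\<^bsub>S\<^esub> n)"
      unfolding hs by (simp add: S.add.nat_pow_Suc)
    also have "\<dots> = [Suc n] \<cdot>\<^bsub>S\<^esub> (h c [^]\<^bsub>S\<^esub> Suc n)"
      using c by (subst S.add_pow_rdistr) (auto simp: S.m_comm)
    finally show ?thesis .
  qed
  ultimately show ?case using x c s by (intro bexI[of _ ?s]) auto
qed

text \<open>
  The polynomial \<open>X\<^sup>n - 1\<close> splits and has degree \<open>n\<close>. A double root \<open>a\<close> would also be a root of
  \<open>(X\<^sup>n - 1) / (X - a)\<close>, whose value at \<open>a\<close> is \<open>n a\<^sup>n\<^sup>-\<^sup>1 \<noteq> 0\<close>.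
\<close>
lemma (in algebraically_closed) card_roots_of_unity:
  assumes n: "[n] \<cdot> \<one> \<noteq> \<zero>"
  shows "card {x \<in> carrier L. x [^] n = \<one>} = n"
proof -
  have n0: "n > 0" using n by (cases n) auto
  interpret UP: domain "poly_ring L"
    using univ_poly_is_domain[OF carrier_is_subring] .
  interpret C: ring_hom_ring L "poly_ring L" poly_of_const
    using canonical_embedding_ring_hom[OF carrier_is_subring] by simp
  have X: "X \<in> carrier (poly_ring L)" using var_closed[OF carrier_is_subring] by simp
  define P where "P = X [^]\<^bsub>poly_ring L\<^esub> n \<ominus>\<^bsub>poly_ring L\<^esub> \<one>\<^bsub>poly_ring L\<^esub>"
  have P: "P \<in> carrier (poly_ring L)" unfolding P_def using X by simp
  have dX: "length (X [^]\<^bsub>poly_ring L\<^esub> n) - 1 = n"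
    using polynomial_pow_degree[OF X, of n] by (simp add: var_def)
  have d1: "length (\<ominus>\<^bsub>poly_ring L\<^esub> \<one>\<^bsub>poly_ring L\<^esub>) - 1 = 0"
    using univ_poly_a_inv_degree[OF carrier_is_subring, of "\<one>\<^bsub>poly_ring L\<^esub>"] UP.one_closed
    by (simp add: univ_poly_one)
  have deg: "length P - 1 = n"
    unfolding P_def a_minus_def univ_poly_add
    using poly_add_degree_eq[OF carrier_is_subring, of "X [^]\<^bsub>poly_ring L\<^esub> n" "\<ominus>\<^bsub>poly_ring L\<^esub> \<one>\<^bsub>poly_ring L\<^esub>"]
      X n0 dX d1 UP.one_closed by (simp add: univ_poly_carrier)
  hence P0: "P \<noteq> []" using n0 by auto
  have ev: "eval P a = a [^] n \<ominus> \<one>" if a: "a \<in> carrier L" for a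
  proof -
    interpret E: ring_hom_ring "poly_ring L" L "\<lambda>p. eval p a"
      using eval_ring_hom[OF carrier_is_subring a] .
    have "eval P a = eval (X [^]\<^bsub>poly_ring L\<^esub> n) a \<oplus> \<ominus> eval \<one>\<^bsub>poly_ring L\<^esub> a"
      unfolding P_def UP.minus_eq using X by (simp only: E.hom_add E.hom_a_inv UP.nat_pow_closed UP.one_closed UP.a_inv_closed)
    also have "\<dots> = a [^] n \<ominus> \<one>"
      unfolding E.hom_nat_pow[OF X] eval_var[OF a] E.hom_one minus_eq ..
    finally show ?thesis .
  qed
  have mem: "a \<in># roots P \<longleftrightarrow> a \<in> carrier L \<and> a [^] n = \<one>" for a
  proof -
    have "a \<in># roots P \<longleftrightarrow> a \<in> carrier L \<and> eval P a = \<zero>"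
      unfolding roots_mem_iff_is_root[OF P] is_root_def using P0 by blast
    also have "\<dots> \<longleftrightarrow> a \<in> carrier L \<and> a [^] n \<ominus> \<one> = \<zero>"
      using ev by metis
    also have "\<dots> \<longleftrightarrow> a \<in> carrier L \<and> a [^] n = \<one>"
      using r_right_minus_eq[OF nat_pow_closed one_closed] by metis
    finally show ?thesis .
  qed
  have simple: "count (roots P) a = 1" if a: "a \<in> carrier L" and an: "a [^] n = \<one>" for a
  proof (rule ccontr)
    assume "count (roots P) a \<noteq> 1"
    moreover have "count (roots P) a > 0" using mem[of a] a an by (simp only: count_greater_zero_iff)
    ultimately have "2 \<le> alg_mult P a" unfolding alg_mult_eq_count_roots[OF P] by linarith
    from le_alg_mult_imp_pdivides[OF a P this]
    obtain Q where Q: "Q \<in> carrier (poly_ring L)"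
      and PQ: "P = [\<one>, \<ominus> a] [^]\<^bsub>poly_ring L\<^esub> (2::nat) \<otimes>\<^bsub>poly_ring L\<^esub> Q"
      unfolding pdivides_def by auto
    have a0: "a \<noteq> \<zero>" using an n0 by (cases n) auto
    let ?c = "poly_of_const a"
    let ?A = "X \<ominus>\<^bsub>poly_ring L\<^esub> ?c"
    have c: "?c \<in> carrier (poly_ring L)" using a by simp
    have "?c = [a]" using a0 by (simp add: poly_of_const_def)
    hence A: "?A = [\<one>, \<ominus> a]"
      unfolding a_minus_def univ_poly_add using univ_poly_a_inv_def'[OF carrier_is_subring c] a
      by (simp add: var_def)
    interpret E: ring_hom_cring "poly_ring L" L "\<lambda>p. eval p a"
      using eval_cring_hom[OF carrier_is_subring a] .
    have "eval X a = a" and "eval ?c a = a"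
      using a \<open>?c = [a]\<close> by (auto simp: eval_var)
    then obtain S where S: "S \<in> carrier (poly_ring L)"
      and eq: "X [^]\<^bsub>poly_ring L\<^esub> n \<ominus>\<^bsub>poly_ring L\<^esub> ?c [^]\<^bsub>poly_ring L\<^esub> n = ?A \<otimes>\<^bsub>poly_ring L\<^esub> S"
      and aS: "a \<otimes> eval S a = [n] \<cdot> (a [^] n)"
      using E.power_diff_cofactor[OF X c, of n] by auto
    have "?c [^]\<^bsub>poly_ring L\<^esub> n = \<one>\<^bsub>poly_ring L\<^esub>"
      using C.hom_nat_pow[OF a, of n] an C.hom_one by simp
    hence "P = ?A \<otimes>\<^bsub>poly_ring L\<^esub> S" using eq by (simp add: P_def)
    moreover have Ac: "?A \<in> carrier (poly_ring L)" using X c by simp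
    moreover have "P = ?A \<otimes>\<^bsub>poly_ring L\<^esub> (?A \<otimes>\<^bsub>poly_ring L\<^esub> Q)"
      using PQ Ac Q unfolding A[symmetric] by (simp add: numeral_2_eq_2 UP.m_assoc)
    moreover have "?A \<noteq> \<zero>\<^bsub>poly_ring L\<^esub>" unfolding A by (simp add: univ_poly_zero)
    ultimately have "S = ?A \<otimes>\<^bsub>poly_ring L\<^esub> Q"
      using S Q UP.m_lcancel[of ?A S "?A \<otimes>\<^bsub>poly_ring L\<^esub> Q"] by simp
    hence "eval S a = eval ?A a \<otimes> eval Q a" using Ac Q by simp
    moreover have "eval ?A a = \<zero>" unfolding A using a by (simp add: r_neg)
    ultimately have "eval S a = \<zero>" using Q by simp
    thus False using aS a an n by simp
  qed
  have "n = size (roots P)"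
    using roots_over_carrier[OF P] deg by (simp add: splitted_def)
  also have "\<dots> = (\<Sum>a\<in>set_mset (roots P). count (roots P) a)"
    by (rule size_multiset_overloaded_eq)
  also have "\<dots> = (\<Sum>a\<in>set_mset (roots P). 1)"
    using simple mem by (intro sum.cong) auto
  also have "set_mset (roots P) = {x \<in> carrier L. x [^] n = \<one>}"
    using mem by auto
  finally show ?thesis by simp
qed

lemma (in ring_hom_ring) hom_nat_multiple:
  assumes "x \<in> carrier R"
  shows "h ([(n::nat)] \<cdot>\<^bsub>R\<^esub> x) = [n] \<cdot>\<^bsub>S\<^esub> h x"
  using assms by (induction n) (simp_all)

text \<open>
  The fixed points of \<open>x \<mapsto> x\<^sup>q\<close> are closed under addition because this map is an iterate of the
  Frobenius map. They are zero and the \<open>(q - 1)\<close>-th roots of unity, of which there are \<open>q - 1\<close>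
  since \<open>q - 1\<close> is \<open>-1\<close> in characteristic \<open>p\<close>.
\<close>
lemma (in algebraically_closed) subfield_of_frobenius_fixed_points:
  assumes p: "prime p" and k: "k > 0" and q: "q = p ^ k"
    and char: "[p] \<cdot> \<one> = \<zero>"
  shows "subfield {x \<in> carrier L. x [^] q = x} L"
    and "card {x \<in> carrier L. x [^] q = x} = q"
proof -
  have charz: "[p] \<cdot> z = \<zero>" if z: "z \<in> carrier L" for z
    using add_pow_ldistr[OF one_closed z, of p] char z by simp
  have q1: "q > 1" unfolding q by (rule one_less_power[OF prime_gt_1_nat[OF p] k])
  let ?F = "{x \<in> carrier L. x [^] q = x}"
  have add: "(x \<oplus> y) [^] q = x [^] q \<oplus> y [^] q" if "x \<in> carrier L" "y \<in> carrier L" for x y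
    unfolding q using that p charz by (rule frobenius_power_add)
  have zero: "\<zero> [^] q = \<zero>" using q1 by (simp add: nat_pow_zero)
  have subring: "subring ?F L"
  proof (rule subringI)
    fix x assume "x \<in> ?F"
    hence x: "x \<in> carrier L" "x [^] q = x" by auto
    have "x \<oplus> (\<ominus> x) [^] q = (x \<oplus> \<ominus> x) [^] q" using add[of x "\<ominus> x"] x by simp
    also have "\<dots> = \<zero>" using x zero by (simp add: r_neg)
    finally have "(\<ominus> x) [^] q = \<ominus> x"
      using x sum_zero_eq_neg by (metis a_inv_closed local.minus_minus minus_equality nat_pow_closed)
    thus "\<ominus> x \<in> ?F" using x by simp
  next
    fix x y assume "x \<in> ?F" "y \<in> ?F"
    thus "x \<otimes> y \<in> ?F" "x \<oplus> y \<in> ?F" using add by (auto simp: nat_pow_distrib)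
  qed auto
  show "subfield ?F L"
  proof (rule subfieldI'[OF subring])
    fix x assume "x \<in> ?F - {\<zero>}"
    hence x: "x \<in> carrier L" "x [^] q = x" "x \<in> Units L" by (auto simp: field_Units)
    have "x \<otimes> (inv x) [^] q = (x \<otimes> inv x) [^] q"
      using x by (simp add: nat_pow_distrib del: Units_r_inv)
    also have "\<dots> = \<one>" using x by simp
    finally have "(inv x) [^] q = inv x"
      using x by (metis Units_inv_closed comm_inv_char nat_pow_closed)
    thus "inv x \<in> ?F" using x by simp
  qed
  \<comment> \<open>Hence \<open>q - 1\<close> equals \<open>-1\<close> in the field and does not vanish.\<close>
  have "[q] \<cdot> \<one> = \<zero>"
  proof -
    obtain j where "q = p * j" using k unfolding q by (cases k) auto
    thus ?thesis using charz by (simp add: add.nat_pow_pow[symmetric] char)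
  qed
  moreover have "[q] \<cdot> \<one> = [(q - 1)] \<cdot> \<one> \<oplus> \<one>"
  proof -
    have "[Suc (q - 1)] \<cdot> \<one> = [(q - 1)] \<cdot> \<one> \<oplus> \<one>" by (rule add.nat_pow_Suc)
    thus ?thesis using q1 by simp
  qed
  ultimately have "[(q - 1)] \<cdot> \<one> \<noteq> \<zero>" by auto
  hence card: "card {x \<in> carrier L. x [^] (q - 1) = \<one>} = q - 1"
    by (rule card_roots_of_unity)
  have eq: "?F = insert \<zero> {x \<in> carrier L. x [^] (q - 1) = \<one>}"
  proof -
    have "x [^] q = x \<longleftrightarrow> x = \<zero> \<or> x [^] (q - 1) = \<one>" if x: "x \<in> carrier L" for x
    proof (cases "x = \<zero>")
      case False
      have "x [^] q = x [^] (q - 1) \<otimes> x" using q1 nat_pow_Suc[of x "q - 1"] by simp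
      moreover have "x = \<one> \<otimes> x" using x by simp
      ultimately have "x [^] q = x \<longleftrightarrow> x [^] (q - 1) = \<one>"
        using x False m_rcancel[of x "x [^] (q - 1)" \<one>] by (metis nat_pow_closed one_closed)
      thus ?thesis using False by simp
    qed (use zero in simp)
    thus ?thesis by auto
  qed
  have "\<zero> [^] (q - 1) = \<zero>" using q1 by (simp add: nat_pow_zero)
  moreover have "finite {x \<in> carrier L. x [^] (q - 1) = \<one>}"
    using card q1 by (intro card_ge_0_finite) simp
  ultimately show "card ?F = q"
    unfolding eq using card q1 by simp
qed

text \<open>
  The type is that of the algebraic closure of a field whose elements are integers.
\<close>
theorem exists_finite_field:
  assumes "primepow q"
  shows "\<exists>F :: ((int list \<times> nat) multiset \<Rightarrow> int) ring. field F \<and> card (carrier F) = q"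
proof -
  obtain p k where p: "prime p" and k: "k > 0" and q: "q = p ^ k"
    using assms unfolding primepow_def by blast
  define R where "R = residue_ring (int p)"
  interpret R: residues_prime p R
    by unfold_locales (use p R_def in auto)
  obtain L :: "((int list \<times> nat) multiset \<Rightarrow> int) ring"
    where L: "algebraic_closure L (R.indexed_const ` carrier R)"
      and hom: "R.indexed_const \<in> Ring.ring_hom R L"
    using R.exists_closure by blast
  interpret L: algebraic_closure L "R.indexed_const ` carrier R" by (rule L)
  interpret h: ring_hom_ring R L "R.indexed_const"
    by (rule ring_hom_ringI2[OF R.ring_axioms L.ring_axioms hom])
  have "[p] \<cdot>\<^bsub>R\<^esub> \<one>\<^bsub>R\<^esub> = \<zero>\<^bsub>R\<^esub>"
    using R.add.pow_order_eq_1[OF R.one_closed]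
    by (simp add: Coset.order_def R.res_carrier_eq)
  hence "[p] \<cdot>\<^bsub>L\<^esub> \<one>\<^bsub>L\<^esub> = \<zero>\<^bsub>L\<^esub>"
    using h.hom_nat_multiple[OF R.one_closed, of p] h.hom_one h.hom_zero by simp
  note F = L.subfield_of_frobenius_fixed_points[OF p k q this]
  show ?thesis
    using L.subfield_iff(2)[OF F(1)] F(2)
    by (intro exI[of _ "L\<lparr>carrier := {x \<in> carrier L. x [^]\<^bsub>L\<^esub> q = x}\<rparr>"]) simp
qed

section \<open>Characters and roots of unity of finite fields\<close>

lemma cis_eq_1_iff_dvd:
  assumes "p > 0"
  shows "cis (2 * pi * of_int t / of_nat p) = 1 \<longleftrightarrow> int p dvd t"
proof
  assume "cis (2 * pi * of_int t / of_nat p) = 1"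
  hence "cos (2 * pi * of_int t / of_nat p) = 1"
    by (simp add: complex_eq_iff)
  then obtain n :: int where "2 * pi * of_int t / of_nat p = of_int n * 2 * pi"
    using cos_one_2pi_int by blast
  hence "of_int t = (of_int (n * int p) :: real)"
    using assms by (simp add: field_simps)
  hence "t = n * int p" by linarith
  thus "int p dvd t" by simp
next
  assume "int p dvd t"
  then obtain n where "t = int p * n" by blast
  hence "2 * pi * of_int t / of_nat p = 2 * pi * of_int n"
    using assms by simp
  thus "cis (2 * pi * of_int t / of_nat p) = 1"
    by (simp add: complex_eq_iff sin_int_2pin cos_int_2pin)
qed

text \<open>
  Take a subgroup \<open>M\<close> that is maximal among those that avoid \<open>a\<close>. Every element then lies in a coset
  of \<open>M\<close> that contains a power of \<open>a\<close>, by maximality, and the exponent of \<open>a\<close> is unique modulo \<open>p\<close>.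
  So the quotient by \<open>M\<close> is cyclic of order \<open>p\<close>, generated by \<open>a\<close>, and has a faithful character.
\<close>
lemma (in comm_group) exists_nontrivial_character:
  assumes fin: "finite (carrier G)" and p: "prime (p::nat)"
    and expo: "\<And>x. x \<in> carrier G \<Longrightarrow> x [^] p = \<one>"
    and a: "a \<in> carrier G" and a1: "a \<noteq> \<one>"
  shows "\<exists>\<chi> :: 'a \<Rightarrow> complex. (\<forall>x\<in>carrier G. \<forall>y\<in>carrier G. \<chi> (x \<otimes> y) = \<chi> x * \<chi> y) \<and>
           (\<forall>x\<in>carrier G. cmod (\<chi> x) = 1) \<and> \<chi> a \<noteq> 1"
proof -
  have p0: "p > 0" using p prime_gt_0_nat by blast
  have per: "x [^] (k::int) = \<one>" if x: "x \<in> carrier G" and k: "int p dvd k" for x k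
  proof -
    obtain j where "k = int p * j" using k by blast
    thus ?thesis using x int_pow_pow[OF x, of "int p" j, symmetric] expo[OF x]
      by (simp add: int_pow_int)
  qed
  have bez: "\<exists>u v. u * k + v * int p = 1" if "\<not> int p dvd k" for k :: int
  proof -
    have "coprime (int p) k" using p that by (intro prime_imp_coprime) auto
    thus ?thesis using bezout_int[of k "int p"] by (auto simp: coprime_iff_gcd_eq_1 gcd.commute)
  qed
  let ?S = "{M. subgroup M G \<and> a \<notin> M}"
  have "finite ?S"
    using fin by (intro finite_subset[of ?S "Pow (carrier G)"]) (auto dest: subgroup.subset)
  moreover have "{\<one>} \<in> ?S" using a1 triv_subgroup by auto
  ultimately obtain M where "M \<in> ?S" and max: "\<And>N. N \<in> ?S \<Longrightarrow> M \<subseteq> N \<Longrightarrow> N = M"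
    using finite_has_maximal[of ?S] by (metis (no_types, lifting) empty_iff)
  hence M: "subgroup M G" and aM: "a \<notin> M" by auto
  note Mc = subgroup.mem_carrier[OF M]
  \<comment> \<open>Otherwise \<open>a\<close> itself would be a power of \<open>a [^] k\<close>, as \<open>a\<close> has order \<open>p\<close>.\<close>
  have dvd: "int p dvd k" if "a [^] k \<in> M" for k :: int
  proof (rule ccontr)
    assume "\<not> int p dvd k"
    then obtain u v where uv: "u * k + v * int p = 1" using bez by blast
    have "a = a [^] (k * u + v * int p)" using a uv by (simp add: mult.commute)
    also have "\<dots> = (a [^] k) [^] u"
      using a per[OF a, of "v * int p"] by (simp add: int_pow_mult int_pow_pow)
    also have "\<dots> \<in> M" using that by (rule subgroup_int_pow_closed[OF M])
    finally show False using aM by simp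
  qed
  have ex: "\<exists>k::int. a [^] k \<otimes> x \<in> M" if x: "x \<in> carrier G" for x
  proof (cases "x \<in> M")
    case True
    thus ?thesis using x by (intro exI[of _ 0]) auto
  next
    case False
    \<comment> \<open>The subgroup generated by \<open>M\<close> and \<open>x\<close> contains \<open>a\<close> by maximality.\<close>
    let ?N = "{m \<otimes> x [^] j | m j. m \<in> M \<and> j \<in> (UNIV :: int set)}"
    have "subgroup ?N G"
    proof (rule subgroupI)
      show "?N \<subseteq> carrier G" using x Mc by auto
      show "?N \<noteq> {}" using subgroup.one_closed[OF M] by blast
      fix y z assume y: "y \<in> ?N" and z: "z \<in> ?N"
      obtain m j where m: "m \<in> M" "y = m \<otimes> x [^] (j::int)" using y by blast
      obtain n i where n: "n \<in> M" "z = n \<otimes> x [^] (i::int)" using z by blast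
      have "inv y = inv m \<otimes> x [^] (- j)"
        using m x Mc by (simp add: inv_mult int_pow_neg)
      thus "inv y \<in> ?N" using subgroup.m_inv_closed[OF M m(1)] by blast
      have "y \<otimes> z = (m \<otimes> n) \<otimes> x [^] (j + i)"
        using m n x Mc by (simp add: int_pow_mult m_ac)
      thus "y \<otimes> z \<in> ?N" using subgroup.m_closed[OF M m(1) n(1)] by blast
    qed
    moreover have "M \<subseteq> ?N"
    proof
      fix m assume "m \<in> M"
      moreover from this have "m = m \<otimes> x [^] (0::int)" using Mc by simp
      ultimately show "m \<in> ?N" by blast
    qed
    moreover have "x \<in> ?N"
    proof -
      have "x = \<one> \<otimes> x [^] (1::int)" using x by simp
      thus ?thesis using subgroup.one_closed[OF M] by blast
    qed
    ultimately have "a \<in> ?N" using max[of ?N] False by blast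
    then obtain m j where m: "m \<in> M" and am: "a = m \<otimes> x [^] (j::int)" by blast
    have "\<not> int p dvd j" using per[OF x, of j] am m Mc aM by auto
    then obtain u v where uv: "u * j + v * int p = 1" using bez by blast
    have "x = x [^] (j * u + v * int p)" using x uv by (simp add: mult.commute)
    also have "\<dots> = (x [^] j) [^] u"
      using x per[OF x, of "v * int p"] by (simp add: int_pow_mult int_pow_pow)
    finally have "a [^] u = m [^] u \<otimes> x"
      using am x Mc[OF m] by (simp add: int_pow_distrib)
    hence "a [^] (- u) \<otimes> x = inv (m [^] u)"
      using a x Mc[OF m] by (simp add: int_pow_neg inv_mult m_assoc)
    thus ?thesis using m subgroup_int_pow_closed[OF M m, of u] subgroup.m_inv_closed[OF M] by metis
  qed
  \<comment> \<open>\<open>\<tau> x\<close> is the exponent of \<open>a\<close> in the inverse of \<open>x\<close> modulo \<open>M\<close>; it is determined only modulo \<open>p\<close>, which suffices for \<open>\<chi>\<close>.\<close>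
  define \<tau> where "\<tau> x = (SOME k::int. a [^] k \<otimes> x \<in> M)" for x
  have \<tau>: "a [^] \<tau> x \<otimes> x \<in> M" if "x \<in> carrier G" for x
    using someI_ex[OF ex[OF that]] by (simp add: \<tau>_def)
  define \<chi> where "\<chi> x = cis (2 * pi * of_int (\<tau> x) / of_nat p)" for x
  have "\<chi> (x \<otimes> y) = \<chi> x * \<chi> y" if x: "x \<in> carrier G" and y: "y \<in> carrier G" for x y
  proof -
    let ?s = "\<tau> x + \<tau> y - \<tau> (x \<otimes> y)"
    have "(a [^] \<tau> x \<otimes> x) \<otimes> (a [^] \<tau> y \<otimes> y) \<otimes> inv (a [^] \<tau> (x \<otimes> y) \<otimes> (x \<otimes> y)) \<in> M"
      by (simp add: subgroup.m_closed[OF M] subgroup.m_inv_closed[OF M] \<tau> x y)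
    also have "(a [^] \<tau> x \<otimes> x) \<otimes> (a [^] \<tau> y \<otimes> y) \<otimes> inv (a [^] \<tau> (x \<otimes> y) \<otimes> (x \<otimes> y))
        = a [^] \<tau> x \<otimes> a [^] \<tau> y \<otimes> inv (a [^] \<tau> (x \<otimes> y)) \<otimes> ((x \<otimes> y) \<otimes> inv (x \<otimes> y))"
      using a x y by (simp only: inv_mult m_closed int_pow_closed inv_closed m_ac)
    also have "\<dots> = a [^] ?s"
      using a x y by (simp add: int_pow_mult int_pow_diff)
    finally have "int p dvd ?s" by (rule dvd)
    hence "cis (2 * pi * of_int ?s / of_nat p) = 1" by (simp only: cis_eq_1_iff_dvd[OF p0])
    hence "\<chi> (x \<otimes> y) = \<chi> (x \<otimes> y) * cis (2 * pi * of_int ?s / of_nat p)" by simp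
    also have "\<dots> = \<chi> x * \<chi> y"
      unfolding \<chi>_def cis_mult by (rule arg_cong[of _ _ cis]) (simp add: field_simps add_divide_distrib diff_divide_distrib)
    finally show ?thesis .
  qed
  moreover have "cmod (\<chi> x) = 1" for x by (simp add: \<chi>_def)
  moreover have "\<chi> a \<noteq> 1"
  proof
    assume "\<chi> a = 1"
    hence "int p dvd \<tau> a" using cis_eq_1_iff_dvd[OF p0] by (simp add: \<chi>_def)
    moreover have "a [^] (\<tau> a + 1) \<in> M" using \<tau>[OF a] a by (simp add: int_pow_mult)
    hence "int p dvd \<tau> a + 1" by (rule dvd)
    ultimately have "int p dvd 1" using dvd_add_right_iff by blast
    thus False using p by (simp add: not_prime_1)
  qed
  ultimately show ?thesis by blast
qed

text \<open>
  The multiplicative group is cyclic, so a suitable power of a generator has order \<open>d\<close>; its powers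
  are \<open>d\<close> distinct roots of \<open>X\<^sup>d - 1\<close>, which has no more than that.
\<close>
lemma (in field) card_roots_of_unity_finite_field:
  assumes fin: "finite (carrier R)" and d: "d dvd card (carrier R) - 1"
  shows "card {x \<in> carrier R. x [^] d = \<one>} = d"
proof -
  let ?U = "{x \<in> carrier R. x [^] d = \<one>}"
  have "{\<zero>, \<one>} \<subseteq> carrier R" by simp
  hence q: "card (carrier R) > 1" using card_mono[OF fin, of "{\<zero>, \<one>}"] by simp
  then obtain m where m: "card (carrier R) - 1 = d * m" and m0: "m \<noteq> 0" and d0: "d \<noteq> 0"
    using d by (metis dvdE less_numeral_extra(3) mult_eq_0_iff zero_less_diff)
  interpret G: group "Multiplicative_Group.mult_of R" by (rule field_mult_group)
  have Gfin: "finite (carrier (Multiplicative_Group.mult_of R))" using fin by (rule finite_mult_of)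
  obtain a where a: "a \<in> carrier (Multiplicative_Group.mult_of R)"
    and gen: "carrier (Multiplicative_Group.mult_of R) = {a [^] i | i::nat. i \<in> UNIV}"
    using finite_field_mult_group_has_gen[OF fin] by blast
  have "G.ord a = card (generate (Multiplicative_Group.mult_of R) {a})" using a by (rule G.generate_pow_card)
  also have "generate (Multiplicative_Group.mult_of R) {a} = carrier (Multiplicative_Group.mult_of R)"
    unfolding G.generate_pow_on_finite_carrier[OF Gfin a] gen Multiplicative_Group.nat_pow_mult_of by simp
  also have "card \<dots> = d * m" using fin m by (simp add: Multiplicative_Group.carrier_mult_of)
  finally have ord_a: "G.ord a = d * m" .
  let ?b = "a [^]\<^bsub>Multiplicative_Group.mult_of R\<^esub> m"
  have b: "?b \<in> carrier (Multiplicative_Group.mult_of R)" using a by (rule G.nat_pow_closed)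
  have ord_b: "G.ord ?b = d"
    using G.ord_pow[OF a, of m] ord_a m0 by simp
  have "inj_on (\<lambda>i. ?b [^]\<^bsub>Multiplicative_Group.mult_of R\<^esub> i) {0..d - 1}"
    using G.ord_inj[OF b] ord_b by simp
  hence "d = card ((\<lambda>i. ?b [^]\<^bsub>Multiplicative_Group.mult_of R\<^esub> i) ` {0..d - 1})"
    using d0 by (simp add: card_image)
  also have "(\<lambda>i. ?b [^]\<^bsub>Multiplicative_Group.mult_of R\<^esub> i) ` {0..d - 1} \<subseteq> ?U"
  proof
    fix y assume "y \<in> (\<lambda>i. ?b [^]\<^bsub>Multiplicative_Group.mult_of R\<^esub> i) ` {0..d - 1}"
    then obtain i where y: "y = ?b [^]\<^bsub>Multiplicative_Group.mult_of R\<^esub> (i::nat)" by blast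
    have yc: "y \<in> carrier (Multiplicative_Group.mult_of R)" using b unfolding y by (rule G.nat_pow_closed)
    have "y [^]\<^bsub>Multiplicative_Group.mult_of R\<^esub> d = (?b [^]\<^bsub>Multiplicative_Group.mult_of R\<^esub> d) [^]\<^bsub>Multiplicative_Group.mult_of R\<^esub> i"
      unfolding y using b by (simp only: G.nat_pow_pow mult.commute)
    also have "?b [^]\<^bsub>Multiplicative_Group.mult_of R\<^esub> d = \<one>\<^bsub>Multiplicative_Group.mult_of R\<^esub>" using G.pow_ord_eq_1[OF b] ord_b by simp
    finally show "y \<in> ?U" using yc by (simp add: Multiplicative_Group.nat_pow_mult_of Multiplicative_Group.carrier_mult_of Multiplicative_Group.one_mult_of)
  qed
  then have "card ((\<lambda>i. ?b [^]\<^bsub>Multiplicative_Group.mult_of R\<^esub> i) ` {0..d - 1}) \<le> card ?U"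
    using fin by (intro card_mono) auto
  finally have "d \<le> card ?U" .
  thus ?thesis using num_roots_le_deg[OF fin d0] by simp
qed

text \<open>
  The additive group has exponent \<open>p\<close>, since \<open>p\<^sup>k \<cdot> 1 = (p \<cdot> 1)\<^sup>k\<close> vanishes.
\<close>
lemma (in field) exists_nontrivial_additive_character:
  assumes q: "primepow (card (carrier R))"
  shows "\<exists>\<chi> :: 'a \<Rightarrow> complex. (\<forall>x\<in>carrier R. \<forall>y\<in>carrier R. \<chi> (x \<oplus> y) = \<chi> x * \<chi> y) \<and>
           (\<forall>x\<in>carrier R. cmod (\<chi> x) = 1) \<and> \<chi> \<one> \<noteq> 1"
proof -
  obtain p k where p: "prime p" and k: "k > 0" and pk: "card (carrier R) = p ^ k"
    using q unfolding primepow_def by blast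
  have fin: "finite (carrier R)" using pk p prime_gt_0_nat[OF p] by (intro card_ge_0_finite) simp
  have "[(p ^ k)] \<cdot> \<one> = \<zero>"
    using add.pow_order_eq_1[OF one_closed] by (simp add: Coset.order_def pk)
  moreover have "[(p ^ k)] \<cdot> \<one> = ([p] \<cdot> \<one>) [^] k"
  proof (induction k)
    case (Suc k)
    have "[(p ^ Suc k)] \<cdot> \<one> = [(p ^ k)] \<cdot> ([p] \<cdot> \<one>)"
      by (simp only: add.nat_pow_pow[OF one_closed] power_Suc)
    also have "\<dots> = [(p ^ k)] \<cdot> \<one> \<otimes> [p] \<cdot> \<one>"
      using add_pow_ldistr[OF one_closed, of "[p] \<cdot> \<one>" "p ^ k"] by simp
    finally show ?case using Suc by simp
  qed (simp add: add.nat_pow_eone)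
  ultimately have pow: "([p] \<cdot> \<one>) [^] k = \<zero>" by simp
  have p1: "[p] \<cdot> \<one> = \<zero>"
  proof (rule ccontr)
    assume "[p] \<cdot> \<one> \<noteq> \<zero>"
    hence "[p] \<cdot> \<one> \<in> Units R" by (simp add: field_Units)
    hence "([p] \<cdot> \<one>) [^] k \<in> Units R" by (rule Units_pow_closed)
    thus False using pow by (simp add: field_Units)
  qed
  have char: "[p] \<cdot> x = \<zero>" if "x \<in> carrier R" for x
    using add_pow_ldistr[OF one_closed that, of p] p1 that by simp
  have "\<exists>\<chi> :: 'a \<Rightarrow> complex.
      (\<forall>x\<in>carrier (add_monoid R). \<forall>y\<in>carrier (add_monoid R). \<chi> (x \<otimes>\<^bsub>add_monoid R\<^esub> y) = \<chi> x * \<chi> y) \<and>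
      (\<forall>x\<in>carrier (add_monoid R). cmod (\<chi> x) = 1) \<and> \<chi> \<one> \<noteq> 1"
    by (rule comm_group.exists_nontrivial_character[OF a_comm_group _ p])
      (use fin char in \<open>simp_all add: add_pow_def\<close>)
  thus ?thesis by simp
qed

section \<open>Inner products and classical squares\<close>

lemma cinner_sum:
  assumes "dim_vec w = n"
  shows "v \<bullet>c w = (\<Sum>i<n. v $ i * cnj (w $ i))"
  using assms by (simp add: scalar_prod_def atLeast0LessThan)

lemma cinner_unit_vec:
  assumes "i < n" "j < n"
  shows "(unit_vec n i :: complex vec) \<bullet>c unit_vec n j = (if i = j then 1 else 0)"
  using assms by (subst scalar_prod_left_unit[where n = n]) auto

text \<open>
  Write the \<open>n\<close> vectors as the rows of a square matrix \<open>A\<close>. Orthonormality says that \<open>A\<close> times its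
  conjugate transpose is the identity; so its determinant is nonzero and the rows are a basis.
\<close>
lemma orthonormal_basisI:
  assumes fin: "finite I" and card: "card I = n"
    and v: "\<And>i. i \<in> I \<Longrightarrow> v i \<in> carrier_vec n"
    and unit: "\<And>i. i \<in> I \<Longrightarrow> v i \<bullet>c v i = 1"
    and orth: "\<And>i j. i \<in> I \<Longrightarrow> j \<in> I \<Longrightarrow> i \<noteq> j \<Longrightarrow> v i \<bullet>c v j = 0"
  shows "orthonormal_basis n I v"
proof -
  obtain xs where xs: "set xs = I" "distinct xs"
    using finite_distinct_list[OF fin] by blast
  interpret vec_space "TYPE(complex)" n .
  have len: "length xs = n" using xs card distinct_card by fastforce
  let ?A = "mat_of_rows n (map v xs)"
  let ?B = "mat_of_cols n (map (\<lambda>i. conjugate (v i)) xs)"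
  have A: "?A \<in> carrier_mat n n" and B: "?B \<in> carrier_mat n n" using len by auto
  have xsI: "xs ! i \<in> I" if "i < n" for i using xs(1) len that nth_mem by blast
  have "?A * ?B = 1\<^sub>m n"
  proof (rule eq_matI)
    fix i j assume "i < dim_row (1\<^sub>m n :: complex mat)" and "j < dim_col (1\<^sub>m n :: complex mat)"
    hence i: "i < n" and j: "j < n" by auto
    have "(?A * ?B) $$ (i, j) = v (xs ! i) \<bullet>c v (xs ! j)"
      using i j len v[OF xsI[OF i]] v[OF xsI[OF j]] by simp
    also have "\<dots> = 1\<^sub>m n $$ (i, j)"
      using i j len xs(2) unit orth xsI by (auto simp: nth_eq_iff_index_eq)
    finally show "(?A * ?B) $$ (i, j) = 1\<^sub>m n $$ (i, j)" .
  qed (use len in auto)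
  hence "det ?A * det ?B = 1" using det_mult[OF A B] by simp
  hence "det ?A \<noteq> 0" by auto
  hence "lin_indpt (set (rows ?A))" by (rule det_not_0_imp_lin_indpt_rows[OF A])
  moreover have sub: "set (map v xs) \<subseteq> carrier_vec n" using xs v by auto
  ultimately have li: "lin_indpt (v ` I)" using xs by simp
  have "inj_on v I"
    using unit orth by (metis inj_onI zero_neq_one)
  hence "card (v ` I) = n" using card by (simp add: card_image)
  hence "basis (v ` I)"
    using li sub xs fin by (intro dim_li_is_basis) (auto simp: dim_is_n)
  thus ?thesis using unit orth unfolding orthonormal_basis_def by auto
qed

lemma tensor_vec_carrier:
  "v \<in> carrier_vec m \<Longrightarrow> w \<in> carrier_vec n \<Longrightarrow> tensor_vec v w \<in> carrier_vec (m * n)"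
  by (auto simp: tensor_vec_def)

lemma cinner_tensor_vec:
  assumes "v \<in> carrier_vec m" "v' \<in> carrier_vec m" "w \<in> carrier_vec n" "w' \<in> carrier_vec n"
  shows "tensor_vec v w \<bullet>c tensor_vec v' w' = (v \<bullet>c v') * (w \<bullet>c w')"
proof -
  have dims: "dim_vec v = m" "dim_vec v' = m" "dim_vec w = n" "dim_vec w' = n" using assms by auto
  let ?f = "\<lambda>a b. (v $ a * cnj (v' $ a)) * (w $ b * cnj (w' $ b))"
  have "tensor_vec v w \<bullet>c tensor_vec v' w' = (\<Sum>k<m * n. ?f (k div n) (k mod n))"
    by (subst cinner_sum[where n = "m * n"]) (auto simp: tensor_vec_def dims intro!: sum.cong)
  also have "\<dots> = (\<Sum>a<m. \<Sum>k\<in>{a * n..<a * n + n}. ?f (k div n) (k mod n))"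
    using sum.nat_group[of "\<lambda>k. ?f (k div n) (k mod n)" n m] by simp
  also have "\<dots> = (\<Sum>a<m. \<Sum>b<n. ?f a b)"
  proof (rule sum.cong[OF refl])
    fix a
    have "(\<Sum>k\<in>{a * n..<a * n + n}. ?f (k div n) (k mod n))
        = (\<Sum>b<n. ?f ((b + a * n) div n) ((b + a * n) mod n))"
      using sum.shift_bounds_nat_ivl[of "\<lambda>k. ?f (k div n) (k mod n)" 0 "a * n" n]
      by (simp add: atLeast0LessThan add.commute)
    also have "\<dots> = (\<Sum>b<n. ?f a b)"
      by (intro sum.cong refl) simp
    finally show "(\<Sum>k\<in>{a * n..<a * n + n}. ?f (k div n) (k mod n)) = (\<Sum>b<n. ?f a b)" .
  qed
  also have "\<dots> = (v \<bullet>c v') * (w \<bullet>c w')"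
    by (simp add: cinner_sum[where n = m] cinner_sum[where n = n] dims sum_product)
  finally show ?thesis .
qed

lemma cinner_unitary:
  assumes U: "unitary_mat n U" and v: "v \<in> carrier_vec n" and w: "w \<in> carrier_vec n"
  shows "(U *\<^sub>v v) \<bullet>c (U *\<^sub>v w) = v \<bullet>c w"
proof -
  have Uc: "U \<in> carrier_mat n n" and UU: "mat_adjoint U * U = 1\<^sub>m n"
    using U by (auto simp: unitary_mat_def)
  have entry: "(\<Sum>i<n. U $$ (i, k) * cnj (U $$ (i, l))) = (if k = l then 1 else 0)"
    if k: "k < n" and l: "l < n" for k l
  proof -
    have "(mat_adjoint U * U) $$ (l, k) = (\<Sum>i<n. cnj (U $$ (i, l)) * U $$ (i, k))"
      using Uc k l by (simp add: mat_adjoint_def scalar_prod_def atLeast0LessThan)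
    moreover have "(mat_adjoint U * U) $$ (l, k) = (if k = l then 1 else 0)"
      using k l UU by simp
    ultimately show ?thesis by (simp add: mult.commute)
  qed
  have mv: "(U *\<^sub>v x) $ i = (\<Sum>k<n. U $$ (i, k) * x $ k)" if "i < n" "x \<in> carrier_vec n" for x i
    using that Uc by (simp add: scalar_prod_def atLeast0LessThan)
  have "(U *\<^sub>v v) \<bullet>c (U *\<^sub>v w)
      = (\<Sum>i<n. (\<Sum>k<n. U $$ (i, k) * v $ k) * (\<Sum>l<n. cnj (U $$ (i, l)) * cnj (w $ l)))"
    using Uc by (subst cinner_sum[where n = n]) (auto simp: mv[OF _ v] mv[OF _ w] simp del: index_mult_mat_vec)
  also have "\<dots> = (\<Sum>i<n. \<Sum>k<n. \<Sum>l<n. (v $ k * cnj (w $ l)) * (U $$ (i, k) * cnj (U $$ (i, l))))"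
    by (simp add: sum_product mult_ac)
  also have "\<dots> = (\<Sum>k<n. \<Sum>i<n. \<Sum>l<n. (v $ k * cnj (w $ l)) * (U $$ (i, k) * cnj (U $$ (i, l))))"
    by (rule sum.swap)
  also have "\<dots> = (\<Sum>k<n. \<Sum>l<n. \<Sum>i<n. (v $ k * cnj (w $ l)) * (U $$ (i, k) * cnj (U $$ (i, l))))"
    by (rule sum.cong[OF refl], rule sum.swap)
  also have "\<dots> = (\<Sum>k<n. \<Sum>l<n. (v $ k * cnj (w $ l)) * (if k = l then 1 else 0))"
    by (intro sum.cong refl) (simp add: sum_distrib_left[symmetric] entry)
  also have "\<dots> = v \<bullet>c w"
  proof -
    have "(\<Sum>l<n. (v $ k * cnj (w $ l)) * (if k = l then 1 else 0)) = v $ k * cnj (w $ k)" if "k < n" for k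
    proof -
      have "(\<Sum>l<n. (v $ k * cnj (w $ l)) * (if k = l then 1 else 0))
          = (\<Sum>l<n. if k = l then v $ k * cnj (w $ l) else 0)"
        by (rule sum.cong) auto
      thus ?thesis using that by simp
    qed
    thus ?thesis using w by (simp add: cinner_sum[where n = n])
  qed
  finally show ?thesis .
qed

text \<open>
  The invariant that detects non-classical squares: phases and a common unitary map do not change the
  moduli of inner products, and for unit vectors of the standard basis these are 0 or 1.
\<close>
lemma classical_qls_cmod_cinner:
  assumes A: "classical_qls n A"
    and carrier: "\<And>i j. i < n \<Longrightarrow> j < n \<Longrightarrow> A $$ (i, j) \<in> carrier_vec n"
    and ij: "i < n" "j < n" and kl: "k < n" "l < n"
  shows "cmod (A $$ (i, j) \<bullet>c A $$ (k, l)) \<in> {0, 1}"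
proof -
  obtain B where iso: "isotopic_qls n A B"
    and B: "\<And>i j. i < n \<Longrightarrow> j < n \<Longrightarrow> B $$ (i, j) \<in> set (unit_vecs n)"
    using A unfolding classical_qls_def by auto
  obtain \<sigma> \<tau> c U where *: "\<sigma> permutes {..<n} \<and> \<tau> permutes {..<n} \<and>
      (\<forall>i<n. \<forall>j<n. cmod (c i j) = 1) \<and> unitary_mat n U \<and>
      (\<forall>i<n. \<forall>j<n. B $$ (i, j) = c i j \<cdot>\<^sub>v (U *\<^sub>v (A $$ (\<sigma> i, \<tau> j))))"
    using iso unfolding isotopic_qls_def by (elim exE)
  hence \<sigma>: "\<sigma> permutes {..<n}" and \<tau>: "\<tau> permutes {..<n}"
    and c: "\<And>i j. i < n \<Longrightarrow> j < n \<Longrightarrow> cmod (c i j) = 1" and U: "unitary_mat n U"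
    and BA: "\<And>i j. i < n \<Longrightarrow> j < n \<Longrightarrow> B $$ (i, j) = c i j \<cdot>\<^sub>v (U *\<^sub>v (A $$ (\<sigma> i, \<tau> j)))"
    by simp_all
  have "\<exists>a<n. \<sigma> a = m" "\<exists>a<n. \<tau> a = m" if "m < n" for m
  proof -
    have "m \<in> \<sigma> ` {..<n}" "m \<in> \<tau> ` {..<n}"
      using that by (simp_all add: permutes_image[OF \<sigma>] permutes_image[OF \<tau>])
    thus "\<exists>a<n. \<sigma> a = m" "\<exists>a<n. \<tau> a = m" by auto
  qed
  then obtain i' j' k' l' where i': "i' < n" "\<sigma> i' = i" and j': "j' < n" "\<tau> j' = j"
    and k': "k' < n" "\<sigma> k' = k" and l': "l' < n" "\<tau> l' = l"
    using ij kl by metis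
  have Uc: "U \<in> carrier_mat n n" using U by (simp add: unitary_mat_def)
  have eqs: "B $$ (i', j') = c i' j' \<cdot>\<^sub>v (U *\<^sub>v (A $$ (i, j)))"
    "B $$ (k', l') = c k' l' \<cdot>\<^sub>v (U *\<^sub>v (A $$ (k, l)))"
    using BA i' j' k' l' by auto
  have "B $$ (i', j') \<bullet>c B $$ (k', l')
      = c i' j' * cnj (c k' l') * ((U *\<^sub>v (A $$ (i, j))) \<bullet>c (U *\<^sub>v (A $$ (k, l))))"
    unfolding eqs using Uc by (simp add: conjugate_smult_vec)
  also have "\<dots> = c i' j' * cnj (c k' l') * (A $$ (i, j) \<bullet>c A $$ (k, l))"
    using cinner_unitary[OF U] carrier ij kl by simp
  finally have "cmod (A $$ (i, j) \<bullet>c A $$ (k, l)) = cmod (B $$ (i', j') \<bullet>c B $$ (k', l'))"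
    using c i' j' k' l' by (simp add: norm_mult)
  moreover have "\<exists>a<n. B $$ (i', j') = unit_vec n a" "\<exists>a<n. B $$ (k', l') = unit_vec n a"
    using B[OF i'(1) j'(1)] B[OF k'(1) l'(1)] by (auto simp: unit_vecs_def)
  ultimately show ?thesis by (auto simp: cinner_unit_vec)
qed

lemma isotopic_qls_refl:
  assumes "\<And>i j. i < n \<Longrightarrow> j < n \<Longrightarrow> A $$ (i, j) \<in> carrier_vec n"
  shows "isotopic_qls n A A"
proof -
  have "unitary_mat n (1\<^sub>m n)"
  proof -
    have "mat_adjoint (1\<^sub>m n :: complex mat) = 1\<^sub>m n"
      by (rule eq_matI) (auto simp: mat_adjoint_def mat_of_rows_def)
    thus ?thesis by (simp add: unitary_mat_def)
  qed
  thus ?thesis unfolding isotopic_qls_def using assms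
    by (intro exI[of _ id] exI[of _ "\<lambda>_ _. 1"] exI[of _ "1\<^sub>m n"]) (auto simp: permutes_id)
qed

section \<open>Squares indexed by the points of a net\<close>

text \<open>
  A net of order \<open>n\<close>: for each parallel class \<open>h \<in> H\<close>, \<open>line h p\<close> numbers the line of that class
  through the point \<open>p\<close>. The classes \<open>r\<close> and \<open>c\<close> turn the \<open>n\<^sup>2\<close> points into the cells of a square.
\<close>
locale net =
  fixes n :: nat and P :: "'p set" and H :: "'h set" and line :: "'h \<Rightarrow> 'p \<Rightarrow> nat" and r c :: 'h
  assumes card_points: "card P = n * n"
    and n_gt_1: "n > 1"
    and line_less: "h \<in> H \<Longrightarrow> p \<in> P \<Longrightarrow> line h p < n"
    and lines_meet_once: "h \<in> H \<Longrightarrow> h' \<in> H \<Longrightarrow> h \<noteq> h' \<Longrightarrow> p \<in> P \<Longrightarrow> p' \<in> P \<Longrightarrow>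
      line h p = line h p' \<Longrightarrow> line h' p = line h' p' \<Longrightarrow> p = p'"
    and finite_classes: "finite H"
    and rows: "r \<in> H" and columns: "c \<in> H" and rows_neq_columns: "r \<noteq> c"
begin

definition cell :: "'p \<Rightarrow> nat \<times> nat" where
  "cell p = (line r p, line c p)"

definition square :: "('p \<Rightarrow> complex vec) \<Rightarrow> complex vec mat" where
  "square \<phi> = mat n n (\<lambda>ij. \<phi> (the_inv_into P cell ij))"

lemma finite_points: "finite P"
  using card_points n_gt_1 by (intro card_ge_0_finite) simp

text \<open>
  Two lines of different classes meet in at most one point, so by counting in exactly one.
\<close>
lemma bij_cell: "bij_betw cell P ({..<n} \<times> {..<n})"
proof -
  have inj: "inj_on cell P"
    using lines_meet_once[OF rows columns rows_neq_columns] by (auto simp: inj_on_def cell_def)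
  moreover have "cell ` P \<subseteq> {..<n} \<times> {..<n}"
    using line_less rows columns by (auto simp: cell_def)
  moreover have "card (cell ` P) = card ({..<n} \<times> {..<n})"
    using inj by (simp add: card_image card_points)
  ultimately show ?thesis
    by (simp add: bij_betw_def card_subset_eq)
qed

lemma square_cell:
  assumes "p \<in> P"
  shows "square \<phi> $$ (line r p, line c p) = \<phi> p"
proof -
  have "the_inv_into P cell (line r p, line c p) = p"
    using assms bij_cell by (metis bij_betw_def cell_def the_inv_into_f_f)
  thus ?thesis using assms line_less rows columns by (simp add: square_def)
qed

lemma cells_cases:
  assumes "i < n" "j < n"
  obtains p where "p \<in> P" "i = line r p" "j = line c p"
proof -
  have "(i, j) \<in> cell ` P" using bij_cell assms by (simp add: bij_betw_def)
  thus ?thesis using that by (auto simp: cell_def)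
qed

lemma square_carrier: "square \<phi> \<in> carrier_mat n n"
  by (simp add: square_def)

lemma square_entry_carrier:
  assumes "\<And>p. p \<in> P \<Longrightarrow> \<phi> p \<in> carrier_vec n" "i < n" "j < n"
  shows "square \<phi> $$ (i, j) \<in> carrier_vec n"
proof -
  obtain p where "p \<in> P" "i = line r p" "j = line c p" using cells_cases assms(2,3) by blast
  thus ?thesis using assms(1) by (simp add: square_cell)
qed

lemma quantum_latin_square_square:
  assumes carrier: "\<And>p. p \<in> P \<Longrightarrow> \<phi> p \<in> carrier_vec n"
    and unit: "\<And>p. p \<in> P \<Longrightarrow> \<phi> p \<bullet>c \<phi> p = 1"
    and orth: "\<And>h p p'. h \<in> {r, c} \<Longrightarrow> p \<in> P \<Longrightarrow> p' \<in> P \<Longrightarrow> p \<noteq> p' \<Longrightarrow>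
      line h p = line h p' \<Longrightarrow> \<phi> p \<bullet>c \<phi> p' = 0"
  shows "quantum_latin_square n (square \<phi>)"
proof -
  have "orthonormal_basis n {..<n} (\<lambda>j. square \<phi> $$ (i, j))" if i: "i < n" for i
  proof (rule orthonormal_basisI)
    fix j assume "j \<in> {..<n}"
    then obtain p where "p \<in> P" "i = line r p" "j = line c p" using cells_cases i by blast
    thus "square \<phi> $$ (i, j) \<in> carrier_vec n" "square \<phi> $$ (i, j) \<bullet>c square \<phi> $$ (i, j) = 1"
      using carrier unit by (auto simp: square_cell)
  next
    fix j j' assume j: "j \<in> {..<n}" "j' \<in> {..<n}" "j \<noteq> j'"
    obtain p where p: "p \<in> P" "i = line r p" "j = line c p" using cells_cases i j by blast
    obtain p' where p': "p' \<in> P" "i = line r p'" "j' = line c p'" using cells_cases i j by blast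
    have "\<phi> p \<bullet>c \<phi> p' = 0" using orth[of r p p'] p p' j(3) by auto
    moreover have "square \<phi> $$ (i, j) = \<phi> p" using p by (simp add: square_cell)
    moreover have "square \<phi> $$ (i, j') = \<phi> p'" using p' by (simp add: square_cell)
    ultimately show "square \<phi> $$ (i, j) \<bullet>c square \<phi> $$ (i, j') = 0" by simp
  qed auto
  moreover have "orthonormal_basis n {..<n} (\<lambda>i. square \<phi> $$ (i, j))" if j: "j < n" for j
  proof (rule orthonormal_basisI)
    fix i assume "i \<in> {..<n}"
    then obtain p where "p \<in> P" "i = line r p" "j = line c p" using cells_cases j by blast
    thus "square \<phi> $$ (i, j) \<in> carrier_vec n" "square \<phi> $$ (i, j) \<bullet>c square \<phi> $$ (i, j) = 1"
      using carrier unit by (auto simp: square_cell)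
  next
    fix i i' assume i: "i \<in> {..<n}" "i' \<in> {..<n}" "i \<noteq> i'"
    obtain p where p: "p \<in> P" "i = line r p" "j = line c p" using cells_cases i j by blast
    obtain p' where p': "p' \<in> P" "i' = line r p'" "j = line c p'" using cells_cases i j by blast
    have "\<phi> p \<bullet>c \<phi> p' = 0" using orth[of c p p'] p p' i(3) by auto
    moreover have "square \<phi> $$ (i, j) = \<phi> p" using p by (simp add: square_cell)
    moreover have "square \<phi> $$ (i', j) = \<phi> p'" using p' by (simp add: square_cell)
    ultimately show "square \<phi> $$ (i, j) \<bullet>c square \<phi> $$ (i', j) = 0" by simp
  qed auto
  ultimately show ?thesis by (simp add: quantum_latin_square_def square_carrier)
qed

lemma orthogonal_qls_squares:
  assumes carrier: "\<And>p. p \<in> P \<Longrightarrow> \<phi> p \<in> carrier_vec n" "\<And>p. p \<in> P \<Longrightarrow> \<psi> p \<in> carrier_vec n"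
    and unit: "\<And>p. p \<in> P \<Longrightarrow> \<phi> p \<bullet>c \<phi> p = 1" "\<And>p. p \<in> P \<Longrightarrow> \<psi> p \<bullet>c \<psi> p = 1"
    and orth: "\<And>p p'. p \<in> P \<Longrightarrow> p' \<in> P \<Longrightarrow> p \<noteq> p' \<Longrightarrow> \<phi> p \<bullet>c \<phi> p' = 0 \<or> \<psi> p \<bullet>c \<psi> p' = 0"
  shows "orthogonal_qls n (square \<phi>) (square \<psi>)"
  unfolding orthogonal_qls_def
proof (rule orthonormal_basisI)
  fix ij assume "ij \<in> {..<n} \<times> {..<n}"
  then obtain p where p: "p \<in> P" "ij = (line r p, line c p)"
    using cells_cases by (metis SigmaE lessThan_iff)
  show "tensor_vec (square \<phi> $$ ij) (square \<psi> $$ ij) \<in> carrier_vec (n * n)"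
    using p carrier by (simp add: square_cell tensor_vec_carrier)
  show "tensor_vec (square \<phi> $$ ij) (square \<psi> $$ ij) \<bullet>c tensor_vec (square \<phi> $$ ij) (square \<psi> $$ ij) = 1"
    using p carrier unit by (simp add: square_cell cinner_tensor_vec[where m = n and n = n])
next
  fix ij kl assume "ij \<in> {..<n} \<times> {..<n}" "kl \<in> {..<n} \<times> {..<n}" "ij \<noteq> kl"
  moreover from this obtain p p' where p: "p \<in> P" "ij = (line r p, line c p)"
    and p': "p' \<in> P" "kl = (line r p', line c p')"
    using cells_cases by (metis SigmaE lessThan_iff)
  ultimately have "p \<noteq> p'" by auto
  hence "(\<phi> p \<bullet>c \<phi> p') * (\<psi> p \<bullet>c \<psi> p') = 0" using orth p p' by simp
  thus "tensor_vec (square \<phi> $$ ij) (square \<psi> $$ ij) \<bullet>c tensor_vec (square \<phi> $$ kl) (square \<psi> $$ kl) = 0"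
    using p p' carrier by (simp add: square_cell cinner_tensor_vec[where m = n and n = n])
qed auto

text \<open>
  The square of a further parallel class of the net is the classical Latin square with the line
  numbers as symbols.
\<close>
abbreviation class_square :: "'h \<Rightarrow> complex vec mat" where
  "class_square h \<equiv> square (\<lambda>p. unit_vec n (line h p))"

lemma class_square_entry_mem:
  assumes "h \<in> H" "i < n" "j < n"
  shows "class_square h $$ (i, j) \<in> set (unit_vecs n)"
proof -
  obtain p where "p \<in> P" "i = line r p" "j = line c p" using cells_cases assms(2,3) by blast
  thus ?thesis using assms(1) line_less by (simp add: square_cell unit_vecs_def)
qed

lemma quantum_latin_class_square:
  assumes h: "h \<in> H - {r, c}"
  shows "quantum_latin_square n (class_square h)"
proof (rule quantum_latin_square_square)
  fix h' p p' assume *: "h' \<in> {r, c}" "p \<in> P" "p' \<in> P" "p \<noteq> p'" "line h' p = line h' p'"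
  hence "line h p \<noteq> line h p'"
    using lines_meet_once[of h h' p p'] h rows columns by auto
  thus "(unit_vec n (line h p) :: complex vec) \<bullet>c unit_vec n (line h p') = 0"
    using h * line_less by (simp add: cinner_unit_vec)
qed (use h line_less in \<open>auto simp: cinner_unit_vec\<close>)

lemma classical_class_square:
  assumes "h \<in> H - {r, c}"
  shows "classical_qls n (class_square h)"
  unfolding classical_qls_def using assms
  by (intro exI[of _ "class_square h"] conjI isotopic_qls_refl quantum_latin_class_square)
    (auto simp: class_square_entry_mem square_entry_carrier)

lemma orthogonal_class_squares:
  assumes "h \<in> H" "h' \<in> H" "h \<noteq> h'"
  shows "orthogonal_qls n (class_square h) (class_square h')"
proof (rule orthogonal_qls_squares)
  fix p p' assume "p \<in> P" "p' \<in> P" "p \<noteq> p'"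
  thus "(unit_vec n (line h p) :: complex vec) \<bullet>c unit_vec n (line h p') = 0 \<or>
    (unit_vec n (line h' p) :: complex vec) \<bullet>c unit_vec n (line h' p') = 0"
    using lines_meet_once[OF assms] line_less assms by (auto simp: cinner_unit_vec)
qed (use assms line_less in \<open>auto simp: cinner_unit_vec\<close>)

lemma inj_on_class_square: "inj_on class_square H"
proof (rule inj_onI, rule ccontr)
  fix h h' assume h: "h \<in> H" "h' \<in> H" "class_square h = class_square h'" "h \<noteq> h'"
  have "line h p = line h' p" if p: "p \<in> P" for p
  proof -
    have "(unit_vec n (line h p) :: complex vec) = unit_vec n (line h' p)"
      using square_cell[OF p, of "\<lambda>p. unit_vec n (line h p)"]
        square_cell[OF p, of "\<lambda>p. unit_vec n (line h' p)"] h(3) by simp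
    thus ?thesis using p h line_less by (metis unit_vec_eq)
  qed
  hence "inj_on (line h) P"
    using lines_meet_once[OF h(1,2,4)] by (auto simp: inj_on_def)
  moreover have "line h ` P \<subseteq> {..<n}" using line_less h by auto
  ultimately have "card P \<le> n" using card_inj_on_le[of "line h" P "{..<n}"] by simp
  thus False using card_points n_gt_1 by simp
qed

text \<open>
  Two points are separated by a classical square of class \<open>h\<close> unless they lie on one line of that class,
  and there \<open>\<psi>\<close> separates them. The pair \<open>p0\<close>, \<open>p1\<close> witnesses that the square of \<open>\<psi>\<close> is not
  classical, so that this square differs from all the others.
\<close>
theorem mutually_orthogonal_one_nonclassical:
  assumes carrier: "\<And>p. p \<in> P \<Longrightarrow> \<psi> p \<in> carrier_vec n"
    and unit: "\<And>p. p \<in> P \<Longrightarrow> \<psi> p \<bullet>c \<psi> p = 1"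
    and orth: "\<And>h p p'. h \<in> H \<Longrightarrow> p \<in> P \<Longrightarrow> p' \<in> P \<Longrightarrow> p \<noteq> p' \<Longrightarrow>
      line h p = line h p' \<Longrightarrow> \<psi> p \<bullet>c \<psi> p' = 0"
    and skew: "p0 \<in> P" "p1 \<in> P" "cmod (\<psi> p0 \<bullet>c \<psi> p1) \<notin> {0, 1}"
  shows "\<exists>S. mutually_orthogonal_qls n S \<and> card S = card H - 1 \<and>
           (\<exists>!A. A \<in> S \<and> \<not> classical_qls n A)"
proof -
  let ?C = "class_square ` (H - {r, c})"
  let ?S = "insert (square \<psi>) ?C"
  have nonclassical: "\<not> classical_qls n (square \<psi>)"
  proof
    assume "classical_qls n (square \<psi>)"
    from classical_qls_cmod_cinner[OF this square_entry_carrier[OF carrier],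
        of "line r p0" "line c p0" "line r p1" "line c p1"]
    show False using skew line_less rows columns by (simp add: square_cell)
  qed
  have classical: "classical_qls n A" if "A \<in> ?C" for A
    using that classical_class_square by auto
  have qls: "quantum_latin_square n (square \<psi>)"
    using carrier unit orth rows columns by (intro quantum_latin_square_square) auto
  have orth1: "orthogonal_qls n (square \<psi>) (class_square h)"
    and orth2: "orthogonal_qls n (class_square h) (square \<psi>)" if h: "h \<in> H" for h
  proof -
    have *: "\<psi> p \<bullet>c \<psi> p' = 0 \<or> (unit_vec n (line h p) :: complex vec) \<bullet>c unit_vec n (line h p') = 0"
      if "p \<in> P" "p' \<in> P" "p \<noteq> p'" for p p'
      using that orth[OF h] line_less[OF h] by (auto simp: cinner_unit_vec)
    show "orthogonal_qls n (square \<psi>) (class_square h)"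
    proof (rule orthogonal_qls_squares)
      fix p p' assume "p \<in> P" "p' \<in> P" "p \<noteq> p'"
      from *[OF this] show "\<psi> p \<bullet>c \<psi> p' = 0 \<or>
        (unit_vec n (line h p) :: complex vec) \<bullet>c unit_vec n (line h p') = 0" by simp
    qed (use carrier unit line_less[OF h] in \<open>auto simp: cinner_unit_vec\<close>)
    show "orthogonal_qls n (class_square h) (square \<psi>)"
    proof (rule orthogonal_qls_squares)
      fix p p' assume "p \<in> P" "p' \<in> P" "p \<noteq> p'"
      from *[OF this] show "(unit_vec n (line h p) :: complex vec) \<bullet>c unit_vec n (line h p') = 0 \<or>
        \<psi> p \<bullet>c \<psi> p' = 0" by blast
    qed (use carrier unit line_less[OF h] in \<open>auto simp: cinner_unit_vec\<close>)
  qed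
  have "mutually_orthogonal_qls n ?S"
    unfolding mutually_orthogonal_qls_def
  proof (intro conjI ballI impI)
    fix A assume "A \<in> ?S"
    thus "quantum_latin_square n A" using qls quantum_latin_class_square by auto
  next
    fix A B assume A: "A \<in> ?S" and B: "B \<in> ?S" and AB: "A \<noteq> B"
    show "orthogonal_qls n A B"
    proof (cases "A = square \<psi>")
      case True
      thus ?thesis using B AB orth1 by auto
    next
      case False
      then obtain h where h: "h \<in> H" "A = class_square h" using A by auto
      show ?thesis
      proof (cases "B = square \<psi>")
        case True
        thus ?thesis using h orth2 by simp
      next
        case False
        then obtain h' where "h' \<in> H" "B = class_square h'" using B by auto
        thus ?thesis using h AB orthogonal_class_squares by metis
      qed
    qed
  qed
  moreover have "card ?S = card H - 1"
  proof -
    have "square \<psi> \<notin> ?C" using nonclassical classical by blast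
    hence "card ?S = Suc (card ?C)" using finite_classes by simp
    also have "card ?C = card (H - {r, c})"
      by (intro card_image inj_on_subset[OF inj_on_class_square]) auto
    also have "\<dots> = card H - 2"
      using rows columns rows_neq_columns by (subst card_Diff_subset) auto
    also have "Suc (card H - 2) = card H - 1"
      using card_mono[of H "{r, c}"] finite_classes rows columns rows_neq_columns by simp
    finally show ?thesis .
  qed
  moreover have "\<exists>!A. A \<in> ?S \<and> \<not> classical_qls n A"
    using nonclassical classical by (intro ex1I[of _ "square \<psi>"]) auto
  ultimately show ?thesis by blast
qed

end

section \<open>The non-classical square\<close>

locale finite_field_character = field R for R (structure) +
  fixes \<chi> :: "'a \<Rightarrow> complex"
  assumes finite_carrier: "finite (carrier R)"
    and \<chi>_add: "x \<in> carrier R \<Longrightarrow> y \<in> carrier R \<Longrightarrow> \<chi> (x \<oplus> y) = \<chi> x * \<chi> y"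
    and cmod_\<chi>: "x \<in> carrier R \<Longrightarrow> cmod (\<chi> x) = 1"
    and \<chi>_one: "\<chi> \<one> \<noteq> 1"
begin

lemma \<chi>_zero: "\<chi> \<zero> = 1"
proof -
  have "\<chi> \<zero> * \<chi> \<zero> = \<chi> \<zero>" using \<chi>_add[of \<zero> \<zero>] by simp
  moreover have "\<chi> \<zero> \<noteq> 0" using cmod_\<chi>[of \<zero>] by auto
  ultimately show ?thesis by simp
qed

lemma \<chi>_minus:
  assumes x: "x \<in> carrier R" and y: "y \<in> carrier R"
  shows "\<chi> (x \<ominus> y) = \<chi> x * cnj (\<chi> y)"
proof -
  have "\<chi> y * \<chi> (\<ominus> y) = 1" using \<chi>_add[OF y a_inv_closed[OF y]] y by (simp add: r_neg \<chi>_zero)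
  moreover have "\<chi> y * cnj (\<chi> y) = 1" using cmod_\<chi>[OF y] by (simp add: complex_norm_square[symmetric])
  moreover have "\<chi> y \<noteq> 0" using cmod_\<chi>[OF y] by auto
  ultimately have "\<chi> (\<ominus> y) = cnj (\<chi> y)" by (metis mult_left_cancel)
  thus ?thesis using \<chi>_add[OF x a_inv_closed[OF y]] by (simp add: minus_eq)
qed

text \<open>
  Translation by 1 permutes the summands and multiplies the sum by \<open>\<chi> \<one> \<noteq> 1\<close>.
\<close>
lemma sum_\<chi>: "(\<Sum>x\<in>carrier R. \<chi> x) = 0"
proof -
  have "inj_on (\<lambda>x. x \<oplus> \<one>) (carrier R)" by (intro inj_onI) simp
  hence "bij_betw (\<lambda>x. x \<oplus> \<one>) (carrier R) (carrier R)"
    using finite_carrier by (intro bij_betw_imageI endo_inj_surj) auto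
  hence "(\<Sum>x\<in>carrier R. \<chi> x) = (\<Sum>x\<in>carrier R. \<chi> (x \<oplus> \<one>))"
    by (rule sum.reindex_bij_betw[symmetric])
  also have "\<dots> = (\<Sum>x\<in>carrier R. \<chi> x) * \<chi> \<one>"
    by (simp add: \<chi>_add sum_distrib_right)
  finally show ?thesis using \<chi>_one by simp
qed

text \<open>
  The key cancellation. Since \<open>H\<close> is closed under multiplication by \<open>h\<close>, multiplying the elements of \<open>H\<close> by
  \<open>h\<close> and fixing all others is a permutation of the field, and so is its composition with
  multiplication by \<open>\<delta>\<close>. The sum is therefore a rearrangement of \<open>\<Sum>x. \<chi> x\<close>.
\<close>
lemma sum_\<chi>_twisted:
  assumes H: "H \<subseteq> carrier R - {\<zero>}" and closed: "\<And>x y. x \<in> H \<Longrightarrow> y \<in> H \<Longrightarrow> x \<otimes> y \<in> H"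
    and h: "h \<in> H" and \<delta>: "\<delta> \<in> carrier R" "\<delta> \<noteq> \<zero>"
  shows "(\<Sum>x\<in>carrier R. \<chi> ((if x \<in> H then h \<otimes> \<delta> else \<delta>) \<otimes> x)) = 0"
proof -
  let ?\<pi> = "\<lambda>x. \<delta> \<otimes> (if x \<in> H then h \<otimes> x else x)"
  have hc: "h \<in> carrier R" "h \<noteq> \<zero>" using h H by auto
  have "inj_on (\<lambda>x. h \<otimes> x) H"
  proof (rule inj_onI)
    fix x y assume "x \<in> H" "y \<in> H" "h \<otimes> x = h \<otimes> y"
    moreover from this have "x \<in> carrier R" "y \<in> carrier R" using H by auto
    ultimately show "x = y" using hc m_lcancel[of h x y] by simp
  qed
  moreover have finH: "finite H" using H finite_carrier finite_subset by blast
  ultimately have "(\<lambda>x. h \<otimes> x) ` H = H"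
    using closed h by (intro endo_inj_surj) auto
  have inj: "inj_on ?\<pi> (carrier R)"
  proof (rule inj_onI)
    fix x y assume x: "x \<in> carrier R" and y: "y \<in> carrier R" and eq: "?\<pi> x = ?\<pi> y"
    have "(if x \<in> H then h \<otimes> x else x) = (if y \<in> H then h \<otimes> y else y)"
      using eq \<delta> x y hc by (subst (asm) m_lcancel) auto
    moreover have "(if z \<in> H then h \<otimes> z else z) \<in> H \<longleftrightarrow> z \<in> H" for z
      using closed h by auto
    ultimately have "x \<in> H \<longleftrightarrow> y \<in> H" "(if x \<in> H then h \<otimes> x else x) = (if y \<in> H then h \<otimes> y else y)"
      by metis+
    thus "x = y" using x y hc by (auto split: if_splits simp: m_lcancel)
  qed
  have "bij_betw ?\<pi> (carrier R) (carrier R)"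
    using finite_carrier inj hc \<delta> by (intro bij_betw_imageI endo_inj_surj) auto
  hence "(\<Sum>x\<in>carrier R. \<chi> (?\<pi> x)) = 0"
    using sum.reindex_bij_betw[of ?\<pi> "carrier R" "carrier R" \<chi>] sum_\<chi> by simp
  moreover have "(if x \<in> H then h \<otimes> \<delta> else \<delta>) \<otimes> x = ?\<pi> x" if "x \<in> carrier R" for x
    using that hc \<delta> by (simp add: m_ac)
  ultimately show ?thesis by simp
qed

text \<open>
  The sum has as many terms of modulus 1 as the field has elements. More than half of them are equal to
  1, so they cannot cancel; the term \<open>\<chi> \<one>\<close> differs from 1, so they do not all have the same direction.
\<close>
lemma sum_\<chi>_subset_strictly_between:
  assumes H: "H \<subseteq> carrier R" and one: "\<one> \<in> H" and small: "2 * card H < card (carrier R)"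
  shows "0 < cmod ((\<Sum>x\<in>H. \<chi> x) + of_nat (card (carrier R - H)))"
    and "cmod ((\<Sum>x\<in>H. \<chi> x) + of_nat (card (carrier R - H))) < card (carrier R)"
proof -
  have finH: "finite H" using H finite_carrier finite_subset by blast
  let ?m = "card (carrier R - H)"
  have m: "real ?m = real (card (carrier R)) - real (card H)"
    using H finH small by (simp add: card_Diff_subset of_nat_diff)
  have bound: "cmod (\<Sum>x\<in>K. \<chi> x) \<le> card K" if "K \<subseteq> H" for K
    using that H sum_norm_le[of K \<chi> "\<lambda>_. 1"] cmod_\<chi> by (simp add: subset_iff)
  have "cmod (of_nat ?m) \<le> cmod ((\<Sum>x\<in>H. \<chi> x) + of_nat ?m) + cmod (\<Sum>x\<in>H. \<chi> x)"
    using norm_triangle_ineq4[of "(\<Sum>x\<in>H. \<chi> x) + of_nat ?m" "\<Sum>x\<in>H. \<chi> x"] by simp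
  hence "real ?m \<le> cmod ((\<Sum>x\<in>H. \<chi> x) + of_nat ?m) + cmod (\<Sum>x\<in>H. \<chi> x)"
    by (simp only: norm_of_nat)
  moreover have "2 * real (card H) < real (card (carrier R))" using small by linarith
  ultimately show "0 < cmod ((\<Sum>x\<in>H. \<chi> x) + of_nat ?m)"
    using bound[OF subset_refl] m by linarith
  have m1: "?m \<ge> 1" using m small by linarith
  \<comment> \<open>Two unit vectors add up to modulus 2 only if they coincide.\<close>
  have "cmod (\<chi> \<one> + 1) < 2"
  proof (rule ccontr)
    assume "\<not> cmod (\<chi> \<one> + 1) < 2"
    hence ge: "4 \<le> (cmod (\<chi> \<one> + 1))\<^sup>2"
      using power_mono[of 2 "cmod (\<chi> \<one> + 1)" 2] by simp
    have n1: "(Re (\<chi> \<one>))\<^sup>2 + (Im (\<chi> \<one>))\<^sup>2 = 1"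
      using cmod_\<chi>[of \<one>] by (simp add: cmod_power2[symmetric])
    have "(cmod (\<chi> \<one> + 1))\<^sup>2 = (Re (\<chi> \<one>))\<^sup>2 + (Im (\<chi> \<one>))\<^sup>2 + 2 * Re (\<chi> \<one>) + 1"
      unfolding cmod_power2 by (simp add: power2_eq_square algebra_simps)
    hence "Re (\<chi> \<one>) \<ge> 1" using ge n1 by linarith
    hence "(Re (\<chi> \<one>))\<^sup>2 \<ge> 1" by (simp add: one_le_power)
    hence "(Im (\<chi> \<one>))\<^sup>2 = 0" and "(Re (\<chi> \<one>))\<^sup>2 = 1"
      using n1 zero_le_power2[of "Im (\<chi> \<one>)"] by linarith+
    hence "Im (\<chi> \<one>) = 0" and "(Re (\<chi> \<one>))\<^sup>2 = 1" by simp_all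
    hence "Re (\<chi> \<one>) = 1" using \<open>Re (\<chi> \<one>) \<ge> 1\<close> by (simp add: power2_eq_1_iff)
    thus False using \<chi>_one \<open>Im (\<chi> \<one>) = 0\<close> by (simp add: complex_eq_iff)
  qed
  moreover have "(\<Sum>x\<in>H. \<chi> x) + of_nat ?m = (\<chi> \<one> + 1) + (\<Sum>x\<in>H - {\<one>}. \<chi> x) + of_nat (?m - 1)"
    using sum.remove[OF finH one, of \<chi>] m1 by (simp add: of_nat_diff)
  hence "cmod ((\<Sum>x\<in>H. \<chi> x) + of_nat ?m)
      \<le> cmod (\<chi> \<one> + 1) + cmod (\<Sum>x\<in>H - {\<one>}. \<chi> x) + real (?m - 1)"
    using norm_triangle_ineq[of "(\<chi> \<one> + 1) + (\<Sum>x\<in>H - {\<one>}. \<chi> x)" "of_nat (?m - 1)"]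
      norm_triangle_ineq[of "\<chi> \<one> + 1" "\<Sum>x\<in>H - {\<one>}. \<chi> x"] by (simp add: norm_of_nat del: of_nat_diff)
  moreover have "cmod (\<Sum>x\<in>H - {\<one>}. \<chi> x) \<le> real (card H) - 1"
  proof -
    have "card H \<ge> 1" using finH one by (metis One_nat_def Suc_leI card_gt_0_iff empty_iff)
    thus ?thesis using bound[of "H - {\<one>}"] finH one by (simp add: of_nat_diff)
  qed
  moreover have "real (?m - 1) = real ?m - 1" using m1 by (simp add: of_nat_diff)
  ultimately show "cmod ((\<Sum>x\<in>H. \<chi> x) + of_nat ?m) < card (carrier R)"
    using m by linarith
qed

lemma same_line_diff:
  assumes "a \<in> carrier R" "a' \<in> carrier R" "b \<in> carrier R" "b' \<in> carrier R" "h \<in> carrier R"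
    and eq: "a \<ominus> h \<otimes> b = a' \<ominus> h \<otimes> b'"
  shows "a \<ominus> a' = h \<otimes> (b \<ominus> b')"
proof -
  have "a \<ominus> a' = (a \<ominus> h \<otimes> b) \<ominus> (a' \<ominus> h \<otimes> b') \<oplus> h \<otimes> (b \<ominus> b')"
    using assms(1-5) by algebra
  also have "\<dots> = h \<otimes> (b \<ominus> b')"
    unfolding eq using assms(1-5) by simp
  finally show ?thesis .
qed

text \<open>
  The classes of the net are the slopes \<open>h \<in> H\<close>, with the lines \<open>a - h b = const\<close> in the plane over the
  field. Rows are the class of slope 1.
\<close>
theorem exists_mutually_orthogonal_qls:
  assumes H: "H \<subseteq> carrier R - {\<zero>}" and closed: "\<And>x y. x \<in> H \<Longrightarrow> y \<in> H \<Longrightarrow> x \<otimes> y \<in> H"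
    and one: "\<one> \<in> H" and card_H: "card H > 1" and small: "2 * card H < card (carrier R)"
  shows "\<exists>S. mutually_orthogonal_qls (card (carrier R)) S \<and> card S = card H - 1 \<and>
           (\<exists>!A. A \<in> S \<and> \<not> classical_qls (card (carrier R)) A)"
proof -
  define q where "q = card (carrier R)"
  have q1: "q > 1" using small card_H by (simp add: q_def)
  have Hc: "h \<in> carrier R" if "h \<in> H" for h using H that by auto
  obtain idx where idx: "bij_betw idx (carrier R) {..<q}"
    using ex_bij_betw_finite_nat[OF finite_carrier] by (auto simp: q_def atLeast0LessThan)
  define e where "e = the_inv_into (carrier R) idx"
  have e: "bij_betw e {..<q} (carrier R)"
    unfolding e_def using idx by (rule bij_betw_the_inv_into)
  obtain g where g: "g \<in> H" "g \<noteq> \<one>"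
    using card_H one by (metis card_le_Suc0_iff_eq card.infinite less_not_refl not_less_eq_eq One_nat_def not_one_less_zero leD)
  define line where "line h p = idx (fst p \<ominus> h \<otimes> snd p)" for h p
  have line_eq: "fst p \<ominus> fst p' = h \<otimes> (snd p \<ominus> snd p')"
    if "h \<in> H" "p \<in> carrier R \<times> carrier R" "p' \<in> carrier R \<times> carrier R" "line h p = line h p'" for h p p'
  proof (rule same_line_diff)
    show "fst p \<ominus> h \<otimes> snd p = fst p' \<ominus> h \<otimes> snd p'"
      using that Hc bij_betw_imp_inj_on[OF idx] by (auto simp: line_def inj_on_eq_iff)
  qed (use that Hc in auto)
  have point_eq: "p = p'"
    if "h \<in> H" "p \<in> carrier R \<times> carrier R" "p' \<in> carrier R \<times> carrier R" "line h p = line h p'"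
      "snd p \<ominus> snd p' = \<zero>" for h p p'
    using line_eq[OF that(1-4)] that Hc by (auto simp: r_right_minus_eq)
  interpret net q "carrier R \<times> carrier R" H line \<one> g
  proof
    show "card (carrier R \<times> carrier R) = q * q" by (simp add: q_def card_cartesian_product)
    show "finite H" using H finite_carrier finite_subset by blast
  next
    fix h p assume "h \<in> H" "p \<in> carrier R \<times> carrier R"
    thus "line h p < q" using bij_betwE[OF idx] Hc by (auto simp: line_def)
  next
    fix h h' p p'
    assume h: "h \<in> H" and h': "h' \<in> H" and neq: "h \<noteq> h'"
      and p: "p \<in> carrier R \<times> carrier R" and p': "p' \<in> carrier R \<times> carrier R"
      and l: "line h p = line h p'" and l': "line h' p = line h' p'"
    let ?\<delta> = "snd p \<ominus> snd p'"
    have \<delta>: "?\<delta> \<in> carrier R" using p p' by auto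
    have "?\<delta> \<otimes> h = ?\<delta> \<otimes> h'"
      using line_eq[OF h p p' l] line_eq[OF h' p p' l'] \<delta> Hc[OF h] Hc[OF h'] by (simp add: m_comm)
    hence "?\<delta> = \<zero>" using m_lcancel[OF _ \<delta> Hc[OF h] Hc[OF h']] neq by blast
    thus "p = p'" by (rule point_eq[OF h p p' l])
  qed (use q1 one g in auto)
  define \<psi> where "\<psi> p = vec q (\<lambda>k. \<chi> ((if e k \<in> H then fst p else snd p) \<otimes> e k) / of_real (sqrt q))" for p
  have inner: "\<psi> p \<bullet>c \<psi> p' = (\<Sum>x\<in>carrier R. \<chi> ((if x \<in> H then fst p \<ominus> fst p' else snd p \<ominus> snd p') \<otimes> x)) / of_nat q"
    if p: "p \<in> carrier R \<times> carrier R" and p': "p' \<in> carrier R \<times> carrier R" for p p'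
  proof -
    let ?f = "\<lambda>x. \<chi> ((if x \<in> H then fst p \<ominus> fst p' else snd p \<ominus> snd p') \<otimes> x) / of_nat q"
    have "\<psi> p \<bullet>c \<psi> p' = (\<Sum>k<q. \<psi> p $ k * cnj (\<psi> p' $ k))"
      by (rule cinner_sum) (simp add: \<psi>_def)
    also have "\<dots> = (\<Sum>k<q. ?f (e k))"
    proof (rule sum.cong[OF refl])
      fix k assume k: "k \<in> {..<q}"
      define x where "x = e k"
      have x: "x \<in> carrier R" using bij_betwE[OF e] k by (simp add: x_def)
      define u where "u = (if x \<in> H then fst p else snd p)"
      define v where "v = (if x \<in> H then fst p' else snd p')"
      have uv: "u \<in> carrier R" "v \<in> carrier R" using p p' by (auto simp: u_def v_def)
      have s: "complex_of_real (sqrt q) * complex_of_real (sqrt q) = of_nat q"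
        by (simp flip: of_real_mult)
      have "\<psi> p $ k * cnj (\<psi> p' $ k) = \<chi> (u \<otimes> x) * cnj (\<chi> (v \<otimes> x)) / of_nat q"
        using k s by (simp add: \<psi>_def x_def u_def v_def)
      also have "\<dots> = \<chi> (u \<otimes> x \<ominus> v \<otimes> x) / of_nat q"
        using uv x by (simp add: \<chi>_minus)
      also have "u \<otimes> x \<ominus> v \<otimes> x = (u \<ominus> v) \<otimes> x"
        using uv x by algebra
      also have "u \<ominus> v = (if x \<in> H then fst p \<ominus> fst p' else snd p \<ominus> snd p')"
        by (simp add: u_def v_def)
      finally show "\<psi> p $ k * cnj (\<psi> p' $ k) = ?f (e k)" by (simp only: x_def)
    qed
    also have "\<dots> = (\<Sum>x\<in>carrier R. ?f x)"
      using e by (rule sum.reindex_bij_betw)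
    finally show ?thesis by (simp add: sum_divide_distrib)
  qed
  let ?T = "(\<Sum>x\<in>H. \<chi> x) + of_nat (card (carrier R - H))"
  \<comment> \<open>These two points differ only in the first coordinate, so the characters off \<open>H\<close> are trivial.\<close>
  have skew: "\<psi> (\<one>, \<zero>) \<bullet>c \<psi> (\<zero>, \<zero>) = ?T / of_nat q"
  proof -
    have "(\<Sum>x\<in>carrier R. \<chi> ((if x \<in> H then \<one> \<ominus> \<zero> else \<zero> \<ominus> \<zero>) \<otimes> x))
        = (\<Sum>x\<in>carrier R. if x \<in> H then \<chi> x else 1)"
      by (intro sum.cong) (auto simp: \<chi>_zero minus_eq)
    also have "\<dots> = (\<Sum>x\<in>carrier R \<inter> {x. x \<in> H}. \<chi> x) + (\<Sum>x\<in>carrier R \<inter> - {x. x \<in> H}. 1)"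
      using finite_carrier by (rule sum.If_cases)
    also have "carrier R \<inter> {x. x \<in> H} = H" using Hc by auto
    also have "carrier R \<inter> - {x. x \<in> H} = carrier R - H" by auto
    finally show ?thesis
      using inner[of "(\<one>, \<zero>)" "(\<zero>, \<zero>)"] unfolding fst_conv snd_conv by simp
  qed
  have "H \<subseteq> carrier R" using Hc by auto
  note T = sum_\<chi>_subset_strictly_between[OF this one small]
  have "\<exists>S. mutually_orthogonal_qls q S \<and> card S = card H - 1 \<and>
           (\<exists>!A. A \<in> S \<and> \<not> classical_qls q A)"
  proof (rule mutually_orthogonal_one_nonclassical)
    show "(\<one>, \<zero>) \<in> carrier R \<times> carrier R" "(\<zero>, \<zero>) \<in> carrier R \<times> carrier R" by auto
    have "0 < cmod ?T / q" "cmod ?T / q < 1" using T q1 by (simp_all add: q_def)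
    moreover have "cmod (\<psi> (\<one>, \<zero>) \<bullet>c \<psi> (\<zero>, \<zero>)) = cmod ?T / q"
      unfolding skew by (simp add: norm_divide)
    ultimately show "cmod (\<psi> (\<one>, \<zero>) \<bullet>c \<psi> (\<zero>, \<zero>)) \<notin> {0, 1}"
      by (metis insert_iff less_irrefl empty_iff)
  next
    fix p assume p: "p \<in> carrier R \<times> carrier R"
    show "\<psi> p \<in> carrier_vec q" by (simp add: \<psi>_def)
    have "(\<Sum>x\<in>carrier R. \<chi> ((if x \<in> H then fst p \<ominus> fst p else snd p \<ominus> snd p) \<otimes> x))
        = (\<Sum>x\<in>carrier R. 1)"
      using p by (intro sum.cong) (auto simp: \<chi>_zero minus_eq r_neg)
    thus "\<psi> p \<bullet>c \<psi> p = 1" using inner[OF p p] q1 by (simp add: q_def)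
  next
    fix h p p' assume h: "h \<in> H" and p: "p \<in> carrier R \<times> carrier R" and p': "p' \<in> carrier R \<times> carrier R"
      and neq: "p \<noteq> p'" and l: "line h p = line h p'"
    let ?\<delta> = "snd p \<ominus> snd p'"
    have "?\<delta> \<in> carrier R" "?\<delta> \<noteq> \<zero>" using p p' neq point_eq[OF h p p' l] by auto
    from sum_\<chi>_twisted[OF H closed h this] show "\<psi> p \<bullet>c \<psi> p' = 0"
      unfolding inner[OF p p'] line_eq[OF h p p' l] by simp
  qed
  thus ?thesis by (simp add: q_def)
qed

end

theorem corollary7:
  fixes q d :: nat
  assumes "primepow q"
    and "d dvd q - 1" and "d \<noteq> q - 1" and "d \<noteq> 1"
  shows "\<exists>S. mutually_orthogonal_qls q S \<and> card S = d - 1 \<and>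
           (\<exists>!A. A \<in> S \<and> \<not> classical_qls q A)"
proof -
  have q1: "q > 1" using primepow_gt_Suc_0[OF assms(1)] by simp
  obtain m where m: "q - 1 = d * m" using assms(2) by blast
  have "d * m \<noteq> 0" using m q1 by linarith
  hence "d \<noteq> 0" "m \<noteq> 0" by simp_all
  moreover have "m \<noteq> 1" using m assms(3) by auto
  ultimately have "d * 2 \<le> d * m" by (intro mult_left_mono) auto
  hence small: "2 * d < q" using m q1 by linarith
  obtain F :: "((int list \<times> nat) multiset \<Rightarrow> int) ring" where "field F" and card: "card (carrier F) = q"
    using exists_finite_field[OF assms(1)] by blast
  interpret field F by fact
  have fin: "finite (carrier F)" using card q1 by (intro card_ge_0_finite) simp
  obtain \<chi> :: "_ \<Rightarrow> complex"
    where \<chi>: "\<forall>x\<in>carrier F. \<forall>y\<in>carrier F. \<chi> (x \<oplus>\<^bsub>F\<^esub> y) = \<chi> x * \<chi> y"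
      "\<forall>x\<in>carrier F. cmod (\<chi> x) = 1" "\<chi> \<one>\<^bsub>F\<^esub> \<noteq> 1"
    using exists_nontrivial_additive_character card assms(1) by blast
  interpret finite_field_character F \<chi>
    using \<chi> fin by unfold_locales auto
  let ?H = "{x \<in> carrier F. x [^]\<^bsub>F\<^esub> d = \<one>\<^bsub>F\<^esub>}"
  have card_H: "card ?H = d"
    using card_roots_of_unity_finite_field[OF fin] card assms(2) by simp
  have H: "?H \<subseteq> carrier F - {\<zero>\<^bsub>F\<^esub>}"
    using \<open>d \<noteq> 0\<close> by (auto simp: nat_pow_zero)
  have "\<exists>S. mutually_orthogonal_qls (card (carrier F)) S \<and> card S = card ?H - 1 \<and>
           (\<exists>!A. A \<in> S \<and> \<not> classical_qls (card (carrier F)) A)"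
    using H
  proof (rule exists_mutually_orthogonal_qls)
    show "x \<otimes>\<^bsub>F\<^esub> y \<in> ?H" if "x \<in> ?H" "y \<in> ?H" for x y
      using that by (auto simp: nat_pow_distrib)
    show "\<one>\<^bsub>F\<^esub> \<in> ?H" by simp
    show "card ?H > 1" using card_H \<open>d \<noteq> 0\<close> assms(4) by simp
    show "2 * card ?H < card (carrier F)" using card_H card small by simp
  qed
  thus ?thesis by (simp only: card card_H)
qed

end
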